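(* Let the thin-tail prior (with parameters $r,\beta>0$) be used. Suppose there exist $g_0\in\Theta_I$ with $g_{q_n}^*$ being its sieve approximation in $\mathcal{H}_n$, and a sequence $B_n^*\to\infty$ such that $$\max\bigl\{G(g_{q_n}^* ),\ \lambda(B_n^* ),\ \gamma(B_n^* )e^{-n\lambda(B_n^* )/q_n}\bigr\}=o\bigl(B_n^{*r}/n\bigr).$$ In addition, suppose that for all $\varepsilon>0$, $$\max\bigl\{G(g_{q_n}^* ),\ \lambda(B_n^* ),\ \gamma(B_n^* )e^{-n\lambda(B_n^* )/q_n}\bigr\}=o\Bigl(\inf_{g\in\mathcal{H}_n,\,g\notin\Theta_I^{\varepsilon}}G(g)\Bigr).$$ Then under Assumptions A1--A4 (listed in the context), for any $\varepsilon>0$, $$P\bigl(d(g_b,\Theta_I)<\varepsilon\mid X^n\bigr)\to 1\quad\text{in probability}.$$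
   Context: Model: $(Z,W)$ is a random vector, $W$ takes values in $[0,1]^d$ ($d$ fixed). $(\mathcal H,\|\cdot\|_s)$ is an infinite-dimensional Banach space of functions of a covariate $X$ (a subvector of the observables); $\mathcal H$ need not be compact. $\rho(Z,g)$ is a known real-valued residual function, $g\in\mathcal H$. The true $g_0$ satisfies $E[\rho(Z,g_0)\mid W]=0$; all expectations are under the true law. $G(g)=E_W\{[E(\rho(Z,g)\mid W)]^2\}$. The identified region $\Theta_I=\{g\in\mathcal H: E(\rho(Z,g)\mid W=w)=0\text{ for almost all }w\}=\{g\in\mathcal H:G(g)=0\}$ is nonempty, not necessarily a singleton. $d(g_1,\Theta_I)=\inf_{g\in\Theta_I}\|g_1-g\|_s$ and $\Theta_I^\varepsilon=\{g\in\mathcal H:d(g,\Theta_I)<\varepsilon\}$. Sieve: $\phi_1,\phi_2,\ldots\in\mathcal H$, integers $q_n\to\infty$, $\mathcal H_n=\mathrm{span}\{\phi_1,\ldots,\phi_{q_n}\}$ (growing dense in $\mathcal H$), $g_b=\sum_{i=1}^{q_n}b_i\phi_i$ for $b\in\mathbb R^{q_n}$; for a sequence $B_n\to\infty$, $\mathcal F_n=\mathcal F_n(B_n)=\{\sum_{i=1}^{q_n}b_i\phi_i:\max_{i\le q_n}|b_i|\le B_n\}$. Likelihood and posterior: data $X^n=\{(Z_i,W_i)\}_{i=1}^n$. For integers $k_n\to\infty$, $[0,1]^d$ is partitioned into the $k_n^d$ cubes $R^n_j$ of the form $\prod_{l=1}^d[\frac{i_l-1}{k_n},\frac{i_l}{k_n}]$,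 $i_l\in\{1,\ldots,k_n\}$. $\bar m_{nj}(g)=\frac1n\sum_{i=1}^n\rho(Z_i,g)I_{(W_i\in R^n_j)}$, $\hat v_j=\frac1n\sum_{i=1}^nI_{(W_i\in R_j^n)}$, $\bar G(g)=\sum_{j=1}^{k_n^d}\bar m_{nj}(g)^2\hat v_j^{-1}$ (terms with $\hat v_j=0$ are read as $0$). The quasi-posterior is $P(g_b\mid X^n)\propto\pi(b)\exp(-\frac n2\bar G(g_b))$. Thin-tail prior: for fixed $\beta>0$, $r>0$, the spherically symmetric density on $\mathbb R^{q_n}$ with $\pi(\|b\|^r>u^r)=e^{-\beta^ru^r}$, i.e. $\pi(b)=r\|b\|^{r-q_n}\beta^re^{-\beta^r\|b\|^r}/S_{q_n}$, where $\|b\|$ is the Euclidean norm and $S_{q_n}$ is the area of the $(q_n-1)$-dimensional unit sphere. Assumptions: A1: the data $(Z_i,W_i)$ are i.i.d. A2: there is a positive sequence $\lambda_n=\lambda(B_n)\to0$ with $\sup_{g\in\mathcal F_n(B_n)}|\bar G(g)-G(g)|=O_p(\lambda(B_n))$ (here used with $B_n=B_n^*$). A3: (i) $\phi_1,\ldots,\phi_{q_n}$ is an orthonormal basis of $\mathcal H_n$, $E(\phi_i(X)\phi_j(X))=\delta_{ij}$ (Kronecker delta); (ii) there exist $g_0\in\Theta_I$ and $g_{q_n}^*=\sum_{i=1}^{q_n}b_i^*\phi_i\in\mathcal H_n$ (the sieve approximation of $g_0$) with $\|g_{q_n}^*-g_0\|_s=o(1)$ as $q_n\to\infty$. A4: there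 is $C>0$ such that $E|\rho(Z,g_1)-\rho(Z,g_2)|\le C\,E|g_1(X)-g_2(X)|$ for all $g_1,g_2\in\mathcal H$. Also $\gamma(B_n)=\sup_{g\in\mathcal F_n(B_n),\,w\in[0,1]^d}|E(\rho(Z,g)\mid W=w)|+1$.
   Formalization: The sieve approximations are additionally assumed to have bounded L²(X) norm, sup_n Σ_i (b_i* )² < ∞ (automatic if ‖·‖_s dominates the L²(X) norm); without any link between ‖·‖_s and L²(X) the claim can fail. *)

theory Defs
  imports "HOL-Probability.Probability"
begin

text \<open>
  An observation is a pair \<open>y = (z, w)\<close> with true law \<open>P\<close>; \<open>fst\<close> and \<open>snd\<close> play the roles of the
  random variables \<open>Z\<close> and \<open>W\<close>.  The Banach space of functions of the covariate is a type
  \<open>'h :: banach\<close> together with an evaluation map \<open>evl\<close> that sends \<open>g\<close> to a function on the range of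
  the covariate.
\<close>

text \<open>
  Linearity of \<open>evl\<close> is only required almost surely: this covers spaces of genuine functions
  as well as spaces of classes modulo null sets (such as \<open>L\<^sup>2\<close>), where \<open>evl\<close> selects representatives.
\<close>

definition function_space ::
  "'y measure \<Rightarrow> 'x measure \<Rightarrow> ('y \<Rightarrow> 'x) \<Rightarrow> ('h::real_vector \<Rightarrow> 'x \<Rightarrow> real) \<Rightarrow> bool" where
  "function_space P SX X evl \<longleftrightarrow>
     inj evl \<and>
     (\<forall>g. evl g \<in> borel_measurable SX) \<and>
     (\<forall>g h. AE y in P. evl (g + h) (X y) = evl g (X y) + evl h (X y)) \<and>
     (\<forall>c g. AE y in P. evl (c *\<^sub>R g) (X y) = c * evl g (X y))"

text \<open>
  \<open>m g w\<close> is a version of \<open>E(\<rho>(Z,g) | W = w)\<close>.  The version is kept as a parameter because a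
  supremum over all \<open>w\<close> is not invariant under changes on null sets.
\<close>

definition cond_mean_version ::
  "('z \<times> (real^'d)) measure \<Rightarrow> ('z \<Rightarrow> 'h \<Rightarrow> real) \<Rightarrow> ('h \<Rightarrow> real^'d \<Rightarrow> real) \<Rightarrow> bool" where
  "cond_mean_version P rho m \<longleftrightarrow>
     (\<forall>g. m g \<in> borel_measurable borel \<and>
          (AE y in P. m g (snd y) =
             real_cond_exp P (vimage_algebra (space P) snd borel) (\<lambda>y. rho (fst y) g) y))"

definition moment_crit ::
  "('z \<times> (real^'d)) measure \<Rightarrow> ('h \<Rightarrow> real^'d \<Rightarrow> real) \<Rightarrow> 'h \<Rightarrow> ereal" where
  "moment_crit P m g = enn2ereal (\<integral>\<^sup>+ y. ennreal ((m g (snd y))\<^sup>2) \<partial>P)"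

definition identified_region ::
  "('z \<times> (real^'d)) measure \<Rightarrow> ('h \<Rightarrow> real^'d \<Rightarrow> real) \<Rightarrow> 'h set" where
  "identified_region P m = {g. AE w in distr P borel snd. m g w = 0}"

definition enlargement :: "'h::metric_space set \<Rightarrow> real \<Rightarrow> 'h set" where
  "enlargement T e = {g. infdist g T < e}"

definition sieve_elem :: "(nat \<Rightarrow> 'h::real_vector) \<Rightarrow> nat \<Rightarrow> (nat \<Rightarrow> real) \<Rightarrow> 'h" where
  "sieve_elem phi q b = (\<Sum>i=1..q. b i *\<^sub>R phi i)"

definition sieve_space :: "(nat \<Rightarrow> 'h::real_vector) \<Rightarrow> nat \<Rightarrow> 'h set" where
  "sieve_space phi q = span (phi ` {1..q})"

definition sieve_box :: "(nat \<Rightarrow> 'h::real_vector) \<Rightarrow> nat \<Rightarrow> real \<Rightarrow> 'h set" where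
  "sieve_box phi q B = {sieve_elem phi q b | b. \<forall>i\<in>{1..q}. \<bar>b i\<bar> \<le> B}"

definition gamma_bound :: "('h \<Rightarrow> real^'d \<Rightarrow> real) \<Rightarrow> 'h set \<Rightarrow> ereal" where
  "gamma_bound m F = (SUP g\<in>F. SUP w\<in>cbox 0 1. ereal \<bar>m g w\<bar>) + 1"

text \<open>
  In the following, \<open>s\<close> is the sequence of observations, of which the first \<open>n\<close> (\<open>s 0, \<dots>, s (n - 1)\<close>)
  are used; the cells are indexed by multi-indices \<open>j\<close> with entries in \<open>{1..k}\<close>.
\<close>

definition cell :: "nat \<Rightarrow> ('d \<Rightarrow> nat) \<Rightarrow> (real^'d) set" where
  "cell k j = cbox (\<chi> l. (real (j l) - 1) / real k) (\<chi> l. real (j l) / real k)"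

definition m_bar ::
  "('z \<Rightarrow> 'h \<Rightarrow> real) \<Rightarrow> nat \<Rightarrow> nat \<Rightarrow> (nat \<Rightarrow> 'z \<times> (real^'d)) \<Rightarrow> ('d \<Rightarrow> nat) \<Rightarrow> 'h \<Rightarrow> real" where
  "m_bar rho n k s j g =
     (1 / real n) * (\<Sum>i<n. rho (fst (s i)) g * indicator (cell k j) (snd (s i)))"

definition v_hat :: "nat \<Rightarrow> nat \<Rightarrow> (nat \<Rightarrow> 'z \<times> (real^'d)) \<Rightarrow> ('d \<Rightarrow> nat) \<Rightarrow> real" where
  "v_hat n k s j = (1 / real n) * (\<Sum>i<n. indicator (cell k j) (snd (s i)))"

text \<open>Terms with \<open>v_hat = 0\<close> vanish since division by zero yields zero.\<close>

definition G_bar ::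
  "('z \<Rightarrow> 'h \<Rightarrow> real) \<Rightarrow> nat \<Rightarrow> nat \<Rightarrow> (nat \<Rightarrow> 'z \<times> (real^'d)) \<Rightarrow> 'h \<Rightarrow> real" where
  "G_bar rho n k s g =
     (\<Sum>j\<in>(\<Pi>\<^sub>E l\<in>(UNIV::'d set). {1..k}). (m_bar rho n k s j g)\<^sup>2 / v_hat n k s j)"

text \<open>Area of the unit sphere in \<open>q\<close>-dimensional Euclidean space.\<close>

definition sphere_area :: "nat \<Rightarrow> real" where
  "sphere_area q = 2 * pi powr (real q / 2) / Gamma (real q / 2)"

definition thin_tail_prior :: "real \<Rightarrow> real \<Rightarrow> nat \<Rightarrow> (nat \<Rightarrow> real) \<Rightarrow> real" where
  "thin_tail_prior r \<beta> q b =
     r * L2_set b {1..q} powr (r - real q) * \<beta> powr r *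
     exp (- (\<beta> powr r * L2_set b {1..q} powr r)) / sphere_area q"

text \<open>
  Lebesgue measure on \<open>q\<close>-dimensional space is the product measure on functions with index set
  \<open>{1..q}\<close>, so that \<open>q\<close> may vary with the sample size.
\<close>

definition unnormalized_posterior ::
  "('z \<Rightarrow> 'h::real_vector \<Rightarrow> real) \<Rightarrow> (nat \<Rightarrow> 'h) \<Rightarrow> real \<Rightarrow> real \<Rightarrow>
   nat \<Rightarrow> nat \<Rightarrow> nat \<Rightarrow> (nat \<Rightarrow> 'z \<times> (real^'d)) \<Rightarrow> (nat \<Rightarrow> real) measure" where
  "unnormalized_posterior rho phi r \<beta> q n k s =
     density (\<Pi>\<^sub>M i\<in>{1..q}. lborel)
       (\<lambda>b. ennreal (thin_tail_prior r \<beta> q b *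
                     exp (- (real n / 2) * G_bar rho n k s (sieve_elem phi q b))))"

text \<open>Quasi-posterior probability of the event \<open>g\<^sub>b \<in> A\<close>.\<close>

definition posterior_prob ::
  "('z \<Rightarrow> 'h::real_vector \<Rightarrow> real) \<Rightarrow> (nat \<Rightarrow> 'h) \<Rightarrow> real \<Rightarrow> real \<Rightarrow>
   nat \<Rightarrow> nat \<Rightarrow> nat \<Rightarrow> (nat \<Rightarrow> 'z \<times> (real^'d)) \<Rightarrow> 'h set \<Rightarrow> real" where
  "posterior_prob rho phi r \<beta> q n k s A =
     (let \<nu> = unnormalized_posterior rho phi r \<beta> q n k s
      in measure \<nu> {b \<in> space \<nu>. sieve_elem phi q b \<in> A} / measure \<nu> (space \<nu>))"

text \<open>
  The stochastic orders are formulated with the outer measure, which agrees with the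
  probability on measurable events; suprema over uncountable classes need not be measurable.
\<close>

definition tendsto_in_prob :: "'o measure \<Rightarrow> (nat \<Rightarrow> 'o \<Rightarrow> real) \<Rightarrow> real \<Rightarrow> bool" where
  "tendsto_in_prob M Y c \<longleftrightarrow>
     (\<forall>\<eta>>0. (\<lambda>n. outer_measure_of M {\<omega>\<in>space M. \<bar>Y n \<omega> - c\<bar> > \<eta>}) \<longlonglongrightarrow> 0)"

definition bigo_in_prob :: "'o measure \<Rightarrow> (nat \<Rightarrow> 'o \<Rightarrow> ereal) \<Rightarrow> (nat \<Rightarrow> real) \<Rightarrow> bool" where
  "bigo_in_prob M Y a \<longleftrightarrow>
     (\<forall>\<eta>>0. \<exists>K. \<forall>\<^sub>F n in sequentially.
        outer_measure_of M {\<omega>\<in>space M. \<bar>Y n \<omega>\<bar> > ereal (K * a n)} \<le> ennreal \<eta>)"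

text \<open>
  Little-o for nonnegative sequences that may take the value \<open>\<infinity>\<close>, e.g. an infimum over the empty
  set on the right-hand side.
\<close>

definition ereal_smallo :: "(nat \<Rightarrow> ereal) \<Rightarrow> (nat \<Rightarrow> ereal) \<Rightarrow> bool" where
  "ereal_smallo a c \<longleftrightarrow> (\<forall>\<delta>>0. \<forall>\<^sub>F n in sequentially. a n \<le> ereal \<delta> * c n)"

definition rate ::
  "('z \<times> (real^'d)) measure \<Rightarrow> ('h::real_vector \<Rightarrow> real^'d \<Rightarrow> real) \<Rightarrow> (nat \<Rightarrow> 'h) \<Rightarrow> (nat \<Rightarrow> nat) \<Rightarrow>
   (nat \<Rightarrow> 'h) \<Rightarrow> (nat \<Rightarrow> real) \<Rightarrow> (nat \<Rightarrow> real) \<Rightarrow> nat \<Rightarrow> ereal" where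
  "rate P m phi q g_star B lam n =
     Max {moment_crit P m (g_star n), ereal (lam n),
          gamma_bound m (sieve_box phi (q n) (B n)) *
            ereal (exp (- (real n * lam n / real (q n))))}"

end

theory Submission
  imports Defs
begin

text \<open>
  The posterior mass outside \<open>\<Theta>\<^sub>I\<^sup>\<epsilon>\<close> is compared with the total unnormalised posterior mass, on the event,
  of probability close to one, on which \<open>\<bar>G\<^sub>n - G\<bar> \<le> K \<lambda>\<^sub>n\<close> uniformly over the coefficient box of
  radius \<open>B\<^sub>n\<close>; here \<open>G\<^sub>n\<close> is the empirical criterion. Write \<open>R\<^sub>n\<close> for the maximum of
  \<open>G(g\<^sup>*)\<close>, \<open>\<lambda>\<^sub>n\<close> and \<open>\<gamma>\<^sub>n exp (- n \<lambda>\<^sub>n / q\<^sub>n)\<close>. Everything is measured on the scale \<open>exp (- n R\<^sub>n)\<close>.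

  Numerator. Inside the box the likelihood is at most \<open>exp (- (n/2) (inf G - K \<lambda>\<^sub>n))\<close>, where the
  infimum is over the sieve space outside \<open>\<Theta>\<^sub>I\<^sup>\<epsilon>\<close>; by separation this is at most \<open>exp (- M n R\<^sub>n)\<close>
  for any constant \<open>M\<close>. Outside the box the likelihood is at most one and the prior has mass at
  most \<open>exp (- \<beta>\<^sup>r B\<^sub>n\<^sup>r)\<close> (\<open>thin_tail_prior_tail\<close>); since \<open>R\<^sub>n = o(B\<^sub>n\<^sup>r / n)\<close>, this is again at most
  \<open>exp (- M n R\<^sub>n)\<close>.

  Denominator. On the sieve, \<open>G\<close> is Lipschitz in the coefficients with constant of order \<open>\<gamma>\<^sub>n\<close>: write
  \<open>a\<^sup>2 - b\<^sup>2 = (a + b) (a - b)\<close> for the two conditional means, bound the sum by \<open>2 \<gamma>\<^sub>n\<close>, and bound the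
  \<open>L\<^sup>1\<close> norm of the difference through the contraction property of conditional expectations, the
  Lipschitz condition on \<open>\<rho>\<close>, and orthonormality of the basis. So \<open>G\<close> is \<open>O(R\<^sub>n)\<close> on a set \<open>U\<close> of
  coefficients within distance \<open>O(R\<^sub>n / \<gamma>\<^sub>n)\<close> of \<open>b\<^sup>*\<close>. It remains to choose such a set with prior mass
  at least \<open>p exp (- L n R\<^sub>n)\<close> (\<open>prior_mass_near_sieve_approximation\<close>). There are two regimes.
  If \<open>n \<lambda>\<^sub>n \<ge> q\<^sub>n\<close>, take the ball of radius \<open>exp (- n \<lambda>\<^sub>n / q\<^sub>n)\<close> around \<open>b\<^sup>*\<close>: the area of the unit sphere
  in the prior density cancels against the volume of the ball, and what is left is
  \<open>exp (- n \<lambda>\<^sub>n - O(q\<^sub>n))\<close>. If \<open>n \<lambda>\<^sub>n < q\<^sub>n\<close>, the factor \<open>exp (- n \<lambda>\<^sub>n / q\<^sub>n)\<close> is bounded below, so that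
  \<open>\<gamma>\<^sub>n = O(R\<^sub>n)\<close>, and a ball around the origin of a fixed radius that carries half of the prior mass
  will do.

  Hence numerator over denominator is at most a constant times \<open>exp (- n R\<^sub>n)\<close>
  (\<open>posterior_concentration_bound\<close>). Finally \<open>n R\<^sub>n \<rightarrow> \<infinity>\<close>: in the first regime
  \<open>n R\<^sub>n \<ge> n \<lambda>\<^sub>n \<ge> q\<^sub>n\<close>, and in the second \<open>R\<^sub>n \<ge> exp (- 1)\<close> because \<open>\<gamma>\<^sub>n \<ge> 1\<close>.
\<close>

section \<open>The moment criterion along the sieve\<close>

text \<open>
  Conditional expectation is linear and an \<open>L\<^sup>1\<close> contraction, so the Lipschitz condition on the
  residual passes on to the conditional means.
\<close>

lemma cond_mean_L1_contraction:
  fixes P :: "('z \<times> (real^'d)) measure" and rho :: "'z \<Rightarrow> 'h \<Rightarrow> real"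
  assumes P: "prob_space P" and sets_P: "sets P = sets (S \<Otimes>\<^sub>M borel)"
    and int: "\<And>g. integrable P (\<lambda>y. rho (fst y) g)"
    and ver: "cond_mean_version P rho m"
  shows "(\<integral>\<^sup>+y. ennreal \<bar>m g (snd y) - m h (snd y)\<bar> \<partial>P)
           \<le> (\<integral>\<^sup>+y. ennreal \<bar>rho (fst y) g - rho (fst y) h\<bar> \<partial>P)"
proof -
  let ?F = "vimage_algebra (space P) snd borel :: ('z \<times> (real^'d)) measure"
  interpret P: prob_space P by (rule P)
  note [measurable_cong] = sets_P
  have [measurable]: "snd \<in> measurable P (borel :: (real^'d) measure)" by measurable
  have sub: "subalgebra P ?F"
    unfolding subalgebra_def
    by (auto simp: sets_vimage_algebra2 intro!: measurable_sets[where M = P and A = borel])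
  interpret F: finite_measure_subalgebra P ?F
    by unfold_locales (rule sub)
  note [measurable] = borel_measurable_integrable[OF int]
  have mAE: "AE y in P. m g (snd y) = real_cond_exp P ?F (\<lambda>y. rho (fst y) g) y" for g
    using ver by (simp add: cond_mean_version_def)
  have "(\<integral>\<^sup>+y. ennreal \<bar>m g (snd y) - m h (snd y)\<bar> \<partial>P)
      \<le> (\<integral>\<^sup>+y. nn_cond_exp P ?F (\<lambda>y. ennreal \<bar>rho (fst y) g - rho (fst y) h\<bar>) y \<partial>P)"
  proof (rule nn_integral_mono_AE)
    show "AE y in P. ennreal \<bar>m g (snd y) - m h (snd y)\<bar>
        \<le> nn_cond_exp P ?F (\<lambda>y. ennreal \<bar>rho (fst y) g - rho (fst y) h\<bar>) y"
      using mAE[of g] mAE[of h] F.real_cond_exp_diff[OF int int, of g h]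
        F.real_cond_exp_abs[OF borel_measurable_diff[OF borel_measurable_integrable[OF int] borel_measurable_integrable[OF int]], of g h]
      by eventually_elim simp
  qed
  also have "\<dots> = (\<integral>\<^sup>+y. ennreal \<bar>rho (fst y) g - rho (fst y) h\<bar> \<partial>P)"
    using F.nn_cond_exp_intg[of "\<lambda>_. 1" "\<lambda>y. ennreal \<bar>rho (fst y) g - rho (fst y) h\<bar>"] by simp
  finally show ?thesis .
qed

text \<open>
  Evaluation is linear only almost surely, one pair of functions at a time; a finite linear combination
  collects finitely many exceptional null sets.
\<close>

lemma AE_evl_sieve_elem:
  assumes "function_space P SX X evl"
  shows "AE y in P. evl (sieve_elem phi q b) (X y) = (\<Sum>i=1..q. b i * evl (phi i) (X y))"
proof (induction q)
  case 0
  have "AE y in P. evl (0 *\<^sub>R 0) (X y) = 0 * evl 0 (X y)"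
    using assms unfolding function_space_def by blast
  thus ?case by (simp add: sieve_elem_def)
next
  case (Suc q)
  have "AE y in P. evl (sieve_elem phi q b + b (Suc q) *\<^sub>R phi (Suc q)) (X y)
      = evl (sieve_elem phi q b) (X y) + evl (b (Suc q) *\<^sub>R phi (Suc q)) (X y)"
    using assms unfolding function_space_def by blast
  moreover have "AE y in P. evl (b (Suc q) *\<^sub>R phi (Suc q)) (X y) = b (Suc q) * evl (phi (Suc q)) (X y)"
    using assms unfolding function_space_def by blast
  ultimately show ?case using Suc by eventually_elim (simp add: sieve_elem_def)
qed

text \<open>
  Pythagoras. Square integrability of the \<open>e i\<close> comes from the normalisation: an integral with value
  \<open>1\<close> cannot be the default value \<open>0\<close> of a non-integrable function.
\<close>

lemma orthonormal_square_integral: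
  fixes e :: "nat \<Rightarrow> 'y \<Rightarrow> real"
  assumes [measurable]: "\<And>i. e i \<in> borel_measurable P"
    and orth: "\<And>i j. 1 \<le> i \<Longrightarrow> 1 \<le> j \<Longrightarrow> (\<integral>y. e i y * e j y \<partial>P) = (if i = j then 1 else 0)"
  shows "(\<integral>\<^sup>+y. ennreal ((\<Sum>i=1..q. a i * e i y)\<^sup>2) \<partial>P) = ennreal ((L2_set a {1..q})\<^sup>2)"
proof -
  have sq: "integrable P (\<lambda>y. (e i y)\<^sup>2)" if "1 \<le> i" for i
  proof (rule ccontr)
    assume "\<not> integrable P (\<lambda>y. (e i y)\<^sup>2)"
    hence "(\<integral>y. (e i y)\<^sup>2 \<partial>P) = 0" by (rule not_integrable_integral_eq)
    thus False using orth[OF that that] by (simp add: power2_eq_square)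
  qed
  have prod: "integrable P (\<lambda>y. e i y * e j y)" if "1 \<le> i" "1 \<le> j" for i j
  proof (rule Bochner_Integration.integrable_bound)
    show "integrable P (\<lambda>y. (e i y)\<^sup>2 + (e j y)\<^sup>2)" using sq that by auto
    have "\<bar>x * z\<bar> \<le> x\<^sup>2 + z\<^sup>2" for x z :: real
    proof -
      have "2 * \<bar>x * z\<bar> \<le> x\<^sup>2 + z\<^sup>2" using sum_squares_bound[of "\<bar>x\<bar>" "\<bar>z\<bar>"] by (simp add: abs_mult)
      thus ?thesis by linarith
    qed
    thus "AE y in P. norm (e i y * e j y) \<le> norm ((e i y)\<^sup>2 + (e j y)\<^sup>2)" by auto
  qed measurable
  have eq: "(\<Sum>i=1..q. a i * e i y)\<^sup>2 = (\<Sum>i=1..q. \<Sum>j=1..q. a i * a j * (e i y * e j y))" for y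
    unfolding power2_eq_square sum_product by (simp add: mult_ac)
  have int: "integrable P (\<lambda>y. (\<Sum>i=1..q. a i * e i y)\<^sup>2)"
    unfolding eq using prod by (intro Bochner_Integration.integrable_sum integrable_mult_right) auto
  have "(\<integral>y. (\<Sum>i=1..q. a i * e i y)\<^sup>2 \<partial>P) = (\<Sum>i=1..q. \<Sum>j=1..q. a i * a j * (\<integral>y. e i y * e j y \<partial>P))"
    unfolding eq using prod
    by (subst Bochner_Integration.integral_sum; (intro sum.cong Bochner_Integration.integrable_sum integrable_mult_right)?; simp)
  also have "\<dots> = (\<Sum>i=1..q. (a i)\<^sup>2)"
    by (rule sum.cong[OF refl]) (auto simp: orth if_distrib power2_eq_square cong: if_cong)
  also have "\<dots> = (L2_set a {1..q})\<^sup>2" by (simp add: L2_set_def sum_nonneg)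
  finally show ?thesis using nn_integral_eq_integral[OF int] by simp
qed

text \<open>
  On a probability space the \<open>L\<^sup>1\<close> norm is at most the \<open>L\<^sup>2\<close> norm, and the latter is the Euclidean
  distance of the coefficients.
\<close>

lemma sieve_L1_le_L2:
  assumes P: "prob_space P" and X: "X \<in> measurable P SX"
    and fs: "function_space P SX X evl"
    and orth: "\<And>i j. 1 \<le> i \<Longrightarrow> 1 \<le> j \<Longrightarrow>
          (\<integral>y. evl (phi i) (X y) * evl (phi j) (X y) \<partial>P) = (if i = j then 1 else 0)"
    and t: "t > 0" "L2_set (\<lambda>i. b i - c i) {1..q} \<le> t"
  shows "(\<integral>\<^sup>+y. ennreal \<bar>evl (sieve_elem phi q b) (X y) - evl (sieve_elem phi q c) (X y)\<bar> \<partial>P) \<le> ennreal t"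
proof -
  interpret P: prob_space P by (rule P)
  have [measurable]: "(\<lambda>y. evl (phi i) (X y)) \<in> borel_measurable P" for i
    using fs X by (intro measurable_compose[OF X]) (auto simp: function_space_def)
  let ?f = "\<lambda>y. \<Sum>i=1..q. (b i - c i) * evl (phi i) (X y)"
  have "(\<integral>\<^sup>+y. ennreal \<bar>evl (sieve_elem phi q b) (X y) - evl (sieve_elem phi q c) (X y)\<bar> \<partial>P)
     = (\<integral>\<^sup>+y. ennreal \<bar>?f y\<bar> \<partial>P)"
  proof (rule nn_integral_cong_AE)
    show "AE y in P. ennreal \<bar>evl (sieve_elem phi q b) (X y) - evl (sieve_elem phi q c) (X y)\<bar> = ennreal \<bar>?f y\<bar>"
      using AE_evl_sieve_elem[OF fs, of phi q b] AE_evl_sieve_elem[OF fs, of phi q c]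
      by eventually_elim (simp add: sum_subtractf left_diff_distrib)
  qed
  also have "\<dots> \<le> (\<integral>\<^sup>+y. (ennreal (t / 2) + ennreal (1 / (2 * t)) * ennreal ((?f y)\<^sup>2)) \<partial>P)"
  proof (rule nn_integral_mono)
    fix y
    \<comment> \<open>Young's inequality with the weight \<open>t\<close> gives the bound \<open>t/2 + t/2\<close> directly.\<close>
    have "2 * (t * \<bar>?f y\<bar>) \<le> t\<^sup>2 + (?f y)\<^sup>2"
      using sum_squares_bound[of t "\<bar>?f y\<bar>"] by simp
    hence "\<bar>?f y\<bar> \<le> t / 2 + 1 / (2 * t) * (?f y)\<^sup>2"
      using t by (simp add: field_simps power2_eq_square)
    thus "ennreal \<bar>?f y\<bar> \<le> ennreal (t / 2) + ennreal (1 / (2 * t)) * ennreal ((?f y)\<^sup>2)"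
      using ennreal_leI[of _ "t / 2 + 1 / (2 * t) * (?f y)\<^sup>2"] t
      by (simp add: ennreal_mult' del: times_divide_eq_left)
  qed
  also have "\<dots> = ennreal (t / 2) + ennreal (1 / (2 * t)) * ennreal ((L2_set (\<lambda>i. b i - c i) {1..q})\<^sup>2)"
    using orthonormal_square_integral[of "\<lambda>i y. evl (phi i) (X y)" P "\<lambda>i. b i - c i" q] orth
    by (simp add: nn_integral_add nn_integral_cmult P.emeasure_space_1)
  also have "\<dots> = ennreal (t / 2 + 1 / (2 * t) * (L2_set (\<lambda>i. b i - c i) {1..q})\<^sup>2)"
    using t by (subst ennreal_plus, simp, simp, subst ennreal_mult') auto
  also have "\<dots> \<le> ennreal t"
  proof (rule ennreal_leI)
    have "(L2_set (\<lambda>i. b i - c i) {1..q})\<^sup>2 \<le> t\<^sup>2"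
      using t L2_set_nonneg by (intro power_mono) auto
    hence "1 / (2 * t) * (L2_set (\<lambda>i. b i - c i) {1..q})\<^sup>2 \<le> 1 / (2 * t) * t\<^sup>2"
      using t by (intro mult_left_mono) auto
    also have "\<dots> = t / 2" using t by (simp add: power2_eq_square)
    finally show "t / 2 + 1 / (2 * t) * (L2_set (\<lambda>i. b i - c i) {1..q})\<^sup>2 \<le> t" by simp
  qed
  finally show ?thesis .
qed

text \<open>
  The difference of squares factors, and the sum of the two conditional means is bounded by
  \<open>2 * \<gamma>\<close>; hence closeness in \<open>L\<^sup>1\<close>, which is all that the residual condition provides, is enough to
  compare two second moments.
\<close>

lemma moment_crit_perturbation:
  fixes P :: "('z \<times> (real^'d)) measure" and m :: "'h \<Rightarrow> real^'d \<Rightarrow> real"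
  assumes snd: "snd \<in> measurable P borel" and m: "\<And>g. m g \<in> borel_measurable borel"
    and W: "AE y in P. snd y \<in> cbox 0 1"
    and bd: "\<And>w. w \<in> cbox 0 1 \<Longrightarrow> \<bar>m g w\<bar> \<le> \<gamma>" "\<And>w. w \<in> cbox 0 1 \<Longrightarrow> \<bar>m h w\<bar> \<le> \<gamma>"
    and \<gamma>: "\<gamma> \<ge> 0" and t: "t \<ge> 0"
    and L1: "(\<integral>\<^sup>+y. ennreal \<bar>m g (snd y) - m h (snd y)\<bar> \<partial>P) \<le> ennreal t"
  shows "moment_crit P m g \<le> moment_crit P m h + ereal (2 * \<gamma> * t)"
proof -
  have [measurable]: "(\<lambda>y. m g (snd y)) \<in> borel_measurable P" for g
    using measurable_compose[OF snd m] .
  have "(\<integral>\<^sup>+y. ennreal ((m g (snd y))\<^sup>2) \<partial>P)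
      \<le> (\<integral>\<^sup>+y. (ennreal ((m h (snd y))\<^sup>2) + ennreal (2 * \<gamma>) * ennreal \<bar>m g (snd y) - m h (snd y)\<bar>) \<partial>P)"
  proof (rule nn_integral_mono_AE)
    show "AE y in P. ennreal ((m g (snd y))\<^sup>2)
        \<le> ennreal ((m h (snd y))\<^sup>2) + ennreal (2 * \<gamma>) * ennreal \<bar>m g (snd y) - m h (snd y)\<bar>"
      using W
    proof eventually_elim
      case (elim y)
      let ?x = "m g (snd y)" and ?z = "m h (snd y)"
      have "?x\<^sup>2 - ?z\<^sup>2 = (?x + ?z) * (?x - ?z)" by (simp add: power2_eq_square algebra_simps)
      also have "\<dots> \<le> \<bar>?x + ?z\<bar> * \<bar>?x - ?z\<bar>" by (metis abs_ge_self abs_mult)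
      also have "\<dots> \<le> (2 * \<gamma>) * \<bar>?x - ?z\<bar>"
        using bd[OF elim] by (intro mult_right_mono) auto
      finally have "?x\<^sup>2 \<le> ?z\<^sup>2 + (2 * \<gamma>) * \<bar>?x - ?z\<bar>" by simp
      thus ?case
        using ennreal_leI[of "?x\<^sup>2" "?z\<^sup>2 + (2 * \<gamma>) * \<bar>?x - ?z\<bar>"] \<gamma> by (simp add: ennreal_mult')
    qed
  qed
  also have "\<dots> = (\<integral>\<^sup>+y. ennreal ((m h (snd y))\<^sup>2) \<partial>P)
      + ennreal (2 * \<gamma>) * (\<integral>\<^sup>+y. ennreal \<bar>m g (snd y) - m h (snd y)\<bar> \<partial>P)"
    by (simp add: nn_integral_add nn_integral_cmult)
  also have "\<dots> \<le> (\<integral>\<^sup>+y. ennreal ((m h (snd y))\<^sup>2) \<partial>P) + ennreal (2 * \<gamma> * t)"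
    using L1 \<gamma> t by (subst ennreal_mult) (auto intro!: add_left_mono mult_left_mono)
  finally have "enn2ereal (\<integral>\<^sup>+y. ennreal ((m g (snd y))\<^sup>2) \<partial>P)
      \<le> enn2ereal ((\<integral>\<^sup>+y. ennreal ((m h (snd y))\<^sup>2) \<partial>P) + ennreal (2 * \<gamma> * t))"
    by (simp add: less_eq_ennreal.rep_eq)
  thus ?thesis using \<gamma> t
    by (simp add: moment_crit_def plus_ennreal.rep_eq enn2ereal_ennreal)
qed

section \<open>The thin-tail prior in polar coordinates\<close>

text \<open>The index sets below are kept in the form \<open>{1..q}\<close>, not \<open>{Suc 0..q}\<close>, under simplification.\<close>

declare One_nat_def [simp del]

abbreviation (input) lebesgue_vec :: "nat \<Rightarrow> (nat \<Rightarrow> real) measure" where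
  "lebesgue_vec q \<equiv> \<Pi>\<^sub>M i\<in>{1..q}. lborel"

lemma measurable_L2_norm [measurable]:
  "(\<lambda>b. L2_set b {1..q}) \<in> borel_measurable (lebesgue_vec q)"
  unfolding L2_set_def by measurable

lemma emeasure_L2_cball:
  assumes "q \<ge> 1" "u \<ge> 0"
  shows "emeasure (lebesgue_vec q) {b \<in> space (lebesgue_vec q). L2_set b {1..q} \<le> u}
           = ennreal (unit_ball_vol (real q) * u ^ q)"
proof (cases "u = 0")
  case True
  interpret product_sigma_finite "\<lambda>_ :: nat. lborel :: real measure" ..
  have "{b \<in> space (lebesgue_vec q). L2_set b {1..q} \<le> u} \<subseteq> (\<Pi>\<^sub>E i\<in>{1..q}. {0})"
  proof (rule subsetI)
    fix b assume b: "b \<in> {b \<in> space (lebesgue_vec q). L2_set b {1..q} \<le> u}"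
    hence "L2_set b {1..q} = 0" using True by (auto intro!: antisym L2_set_nonneg)
    hence "b i = 0" if "i \<in> {1..q}" for i using that by (simp add: L2_set_eq_0_iff)
    thus "b \<in> (\<Pi>\<^sub>E i\<in>{1..q}. {0})" using b by (auto simp: space_PiM PiE_def extensional_def fun_eq_iff)
  qed
  hence "emeasure (lebesgue_vec q) {b \<in> space (lebesgue_vec q). L2_set b {1..q} \<le> u}
           \<le> emeasure (lebesgue_vec q) (\<Pi>\<^sub>E i\<in>{1..q}. {0})"
    by (intro emeasure_mono sets_PiM_I_finite) auto
  also have "\<dots> = 0" using assms by (subst emeasure_PiM) (auto simp: power_0_left)
  finally show ?thesis using True assms by (simp add: power_0_left)
next
  case False
  thus ?thesis using emeasure_cball_aux[of "{1..q}" u] assms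
    by (simp add: L2_set_def Int_def conj_commute)
qed

text \<open>
  Integration in polar coordinates, for radial functions only: both measures give a half-line
  \<open>{..u}\<close> the volume of the ball of radius \<open>u\<close>.
\<close>

lemma distr_L2_norm:
  assumes "q \<ge> 1"
  shows "distr (lebesgue_vec q) borel (\<lambda>b. L2_set b {1..q})
           = density lborel (\<lambda>t. ennreal (real q * unit_ball_vol (real q) * t ^ (q - 1)) * indicator {0..} t)"
    (is "?M = ?N")
proof (rule measure_eqI_generator_eq[where E = "range atMost" and \<Omega> = UNIV and A = "\<lambda>i. {..real i}"])
  have M: "emeasure ?M {..u} = (if u < 0 then 0 else ennreal (unit_ball_vol (real q) * u ^ q))" for u
  proof -
    have "emeasure ?M {..u} =
        emeasure (lebesgue_vec q) {b \<in> space (lebesgue_vec q). L2_set b {1..q} \<le> u}"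
      by (subst emeasure_distr) (auto intro!: arg_cong[where f = "emeasure _"])
    moreover have "{b \<in> space (lebesgue_vec q). L2_set b {1..q} \<le> u} = {}" if "u < 0"
      using that by (auto simp: not_le intro: less_le_trans[OF _ L2_set_nonneg])
    ultimately show ?thesis using emeasure_L2_cball[OF assms, of u] by (cases "u < 0") auto
  qed
  have N: "emeasure ?N {..u} = (if u < 0 then 0 else ennreal (unit_ball_vol (real q) * u ^ q))" for u
  proof -
    have "emeasure ?N {..u} =
        (\<integral>\<^sup>+t. ennreal (real q * unit_ball_vol (real q) * t ^ (q - 1)) * indicator {0..u} t \<partial>lborel)"
      by (subst emeasure_density) (auto intro!: nn_integral_cong simp: indicator_def)
    also have "\<dots> = (if u < 0 then 0 else ennreal (unit_ball_vol (real q) * u ^ q))"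
    proof (cases "u < 0")
      case False
      have "(\<integral>\<^sup>+t. ennreal (real q * unit_ball_vol (real q) * t ^ (q - 1)) * indicator {0..u} t \<partial>lborel)
          = ennreal (unit_ball_vol (real q) * u ^ q - unit_ball_vol (real q) * 0 ^ q)"
        using False by (intro nn_integral_FTC_Icc)
          (auto intro!: derivative_eq_intros simp: One_nat_def[symmetric]
              simp flip: has_real_derivative_iff_has_vector_derivative)
      thus ?thesis using False assms by (simp add: power_0_left)
    qed auto
    finally show ?thesis .
  qed
  show "emeasure ?M X = emeasure ?N X" if "X \<in> range atMost" for X
    using that M N by auto
  show "emeasure ?M {..real i} \<noteq> \<infinity>" for i by (simp add: M)
  show "Int_stable (range (atMost :: real \<Rightarrow> _))"
    by (auto simp: Int_stable_def)
  show "sets ?M = sigma_sets UNIV (range atMost)" "sets ?N = sigma_sets UNIV (range atMost)"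
    by (simp_all add: borel_eq_atMost)
  show "(\<Union>i. {..real i}) = UNIV" using real_arch_simple by blast
qed auto

lemma sphere_area_eq: "q \<ge> 1 \<Longrightarrow> sphere_area q = real q * unit_ball_vol (real q)"
  using Gamma_plus1[of "real q / 2"]
  by (auto simp: sphere_area_def unit_ball_vol_def nonpos_Ints_def divide_simps Gamma_eq_zero_iff)

definition prior_measure :: "real \<Rightarrow> real \<Rightarrow> nat \<Rightarrow> (nat \<Rightarrow> real) measure" where
  "prior_measure r \<beta> q = density (lebesgue_vec q) (\<lambda>b. ennreal (thin_tail_prior r \<beta> q b))"

lemma measurable_thin_tail_prior [measurable]:
  "thin_tail_prior r \<beta> q \<in> borel_measurable (lebesgue_vec q)"
  unfolding thin_tail_prior_def by measurable

lemma sets_prior_measure [measurable_cong, simp]: "sets (prior_measure r \<beta> q) = sets (lebesgue_vec q)"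
  by (simp add: prior_measure_def)

lemma space_prior_measure [simp]: "space (prior_measure r \<beta> q) = space (lebesgue_vec q)"
  by (simp add: prior_measure_def)

text \<open>
  In the radial variable the factor \<open>t powr (r - q)\<close> of the density meets the factor \<open>t ^ (q - 1)\<close> of the
  volume element, the sphere area cancels, and the integrand is the derivative of
  \<open>- exp (- (\<beta> powr r * t powr r))\<close>. The radius \<open>u\<close> stays positive because this antiderivative is not
  differentiable at \<open>0\<close> when \<open>r < 1\<close>.
\<close>

lemma thin_tail_prior_tail:
  assumes "q \<ge> 1" "r > 0" "\<beta> > 0" "u > 0"
  shows "emeasure (prior_measure r \<beta> q) {b \<in> space (lebesgue_vec q). u \<le> L2_set b {1..q}}
           = ennreal (exp (- (\<beta> powr r * u powr r)))"
proof -
  let ?h = "\<lambda>t. r * t powr (r - real q) * \<beta> powr r * exp (- (\<beta> powr r * t powr r)) / sphere_area q"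
  have S: "sphere_area q > 0" using assms by (simp add: sphere_area_eq)
  have "emeasure (prior_measure r \<beta> q) {b \<in> space (lebesgue_vec q). u \<le> L2_set b {1..q}}
     = (\<integral>\<^sup>+b. ennreal (?h (L2_set b {1..q})) * indicator {u..} (L2_set b {1..q}) \<partial>lebesgue_vec q)"
    unfolding prior_measure_def thin_tail_prior_def
    by (subst emeasure_density) (auto intro!: nn_integral_cong simp: indicator_def)
  also have "\<dots> = (\<integral>\<^sup>+t. ennreal (?h t) * indicator {u..} t
                      \<partial>distr (lebesgue_vec q) borel (\<lambda>b. L2_set b {1..q}))"
    by (subst nn_integral_distr) auto
  also have "\<dots> = (\<integral>\<^sup>+t. ennreal (r * \<beta> powr r * t powr (r - 1) * exp (- (\<beta> powr r * t powr r)))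
                      * indicator {u..} t \<partial>lborel)"
  proof -
    have *: "ennreal (real q * unit_ball_vol (real q) * t ^ (q - 1)) * indicator {0..} t *
        (ennreal (?h t) * indicator {u..} t)
      = ennreal (r * \<beta> powr r * t powr (r - 1) * exp (- (\<beta> powr r * t powr r))) * indicator {u..} t" for t
    proof (cases "t \<ge> u")
      case True
      hence t: "t > 0" using assms by auto
      have "t ^ (q - 1) * t powr (r - real q) = t powr (r - 1)"
        using t assms by (simp add: powr_realpow[symmetric] powr_add[symmetric] of_nat_diff)
      hence "real q * unit_ball_vol (real q) * t ^ (q - 1) * ?h t
          = r * \<beta> powr r * t powr (r - 1) * exp (- (\<beta> powr r * t powr r))"
        using assms S unit_ball_vol_pos[of "real q"]
        by (simp add: sphere_area_eq divide_simps mult_ac del: unit_ball_vol_pos)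
      moreover have "?h t \<ge> 0" using assms S by (intro divide_nonneg_pos mult_nonneg_nonneg) auto
      ultimately show ?thesis using True t assms S
        by (simp add: indicator_def ennreal_mult'[symmetric] ennreal_mult''[symmetric] del: times_divide_eq_right)
    qed (simp add: indicator_def)
    show ?thesis
      by (simp only: distr_L2_norm[OF assms(1)], subst nn_integral_density) (simp_all only: *, measurable)
  qed
  also have "\<dots> = ennreal (0 - (- exp (- (\<beta> powr r * u powr r))))"
  proof (rule nn_integral_FTC_atLeast)
    fix t assume "u \<le> t"
    hence t: "t > 0" using assms by auto
    show "((\<lambda>t. - exp (- (\<beta> powr r * t powr r))) has_real_derivative
        (r * \<beta> powr r * t powr (r - 1) * exp (- (\<beta> powr r * t powr r)))) (at t)"
      using t by (auto intro!: derivative_eq_intros simp: field_simps)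
    show "0 \<le> r * \<beta> powr r * t powr (r - 1) * exp (- (\<beta> powr r * t powr r))" using assms by auto
  next
    show "((\<lambda>t. - exp (- (\<beta> powr r * t powr r))) \<longlongrightarrow> 0) at_top"
      using assms by real_asymp
  qed measurable
  finally show ?thesis by simp
qed

text \<open>
  The tail formula is exhausted by radii \<open>1 / Suc n\<close>, which leaves out only the origin.
\<close>

lemma emeasure_prior_space:
  assumes "q \<ge> 1" "r > 0" "\<beta> > 0"
  shows "emeasure (prior_measure r \<beta> q) (space (lebesgue_vec q)) = 1"
proof -
  let ?P = "prior_measure r \<beta> q"
  define T where "T n = {b \<in> space (lebesgue_vec q). 1 / real (Suc n) \<le> L2_set b {1..q}}" for n
  define Z where "Z = {b \<in> space (lebesgue_vec q). L2_set b {1..q} = 0}"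
  have Z [measurable]: "Z \<in> sets (lebesgue_vec q)" unfolding Z_def by measurable
  have T [measurable]: "T n \<in> sets (lebesgue_vec q)" for n unfolding T_def by measurable
  have "incseq T"
  proof (rule incseq_SucI)
    fix n
    have "1 / real (Suc (Suc n)) \<le> 1 / real (Suc n)" by (simp add: divide_simps)
    thus "T n \<subseteq> T (Suc n)" by (auto simp: T_def)
  qed
  have un: "space (lebesgue_vec q) = Z \<union> (\<Union>n. T n)"
  proof (intro equalityI subsetI)
    fix b assume b: "b \<in> space (lebesgue_vec q)"
    show "b \<in> Z \<union> (\<Union>n. T n)"
    proof (cases "L2_set b {1..q} = 0")
      case False
      hence "L2_set b {1..q} > 0" using L2_set_nonneg[of b "{1..q}"] by linarith
      then obtain n where "1 / real (Suc n) < L2_set b {1..q}"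
        using nat_approx_posE by blast
      thus ?thesis using b by (auto simp: T_def intro: less_imp_le)
    qed (use b in \<open>auto simp: Z_def\<close>)
  qed (auto simp: Z_def T_def)
  \<comment> \<open>The density vanishes at the origin because \<open>0 powr x = 0\<close>.\<close>
  have Z0: "emeasure ?P Z = 0"
    unfolding prior_measure_def
    by (subst emeasure_density)
      (auto intro!: nn_integral_0_iff_AE[THEN iffD2] AE_I2 simp: Z_def thin_tail_prior_def indicator_def)
  have "(\<lambda>n. emeasure ?P (T n)) \<longlonglongrightarrow> emeasure ?P (\<Union>n. T n)"
    using \<open>incseq T\<close> by (intro Lim_emeasure_incseq) auto
  moreover have "(\<lambda>n. emeasure ?P (T n)) \<longlonglongrightarrow> ennreal 1"
  proof -
    have "emeasure ?P (T n) = ennreal (exp (- (\<beta> powr r * (1 / real (Suc n)) powr r)))" for n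
      using thin_tail_prior_tail[OF assms, of "1 / real (Suc n)"] by (simp add: T_def)
    moreover have "(\<lambda>n. exp (- (\<beta> powr r * (1 / real (Suc n)) powr r))) \<longlonglongrightarrow> 1"
      using assms by real_asymp
    ultimately show ?thesis by (simp only:) (rule tendsto_ennrealI)
  qed
  ultimately have "emeasure ?P (\<Union>n. T n) = 1"
    by (metis LIMSEQ_unique ennreal_1)
  moreover have "emeasure ?P (Z \<union> (\<Union>n. T n)) = emeasure ?P (\<Union>n. T n)"
    using Z0 by (subst Un_commute, intro emeasure_Un_null_set) (auto simp: null_sets_def)
  ultimately show ?thesis by (simp add: un)
qed

lemma prob_space_prior_measure:
  assumes "q \<ge> 1" "r > 0" "\<beta> > 0"
  shows "prob_space (prior_measure r \<beta> q)"
  by (rule prob_spaceI) (simp add: emeasure_prior_space[OF assms])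

text \<open>
  The radial law of the prior does not depend on the dimension, so one radius serves all \<open>q\<close>.
\<close>

lemma prior_half_ball:
  assumes "r > 0" "\<beta> > 0"
  obtains u where "u > 0" "\<And>q. q \<ge> 1 \<Longrightarrow>
    measure (prior_measure r \<beta> q) {b \<in> space (lebesgue_vec q). L2_set b {1..q} < u} \<ge> 1 / 2"
proof -
  have "((\<lambda>u. exp (- (\<beta> powr r * u powr r))) \<longlongrightarrow> 0) at_top"
    using assms by real_asymp
  hence "eventually (\<lambda>u. exp (- (\<beta> powr r * u powr r)) < 1 / 2) at_top"
    by (rule order_tendstoD) simp
  hence "eventually (\<lambda>u. u > 0 \<and> exp (- (\<beta> powr r * u powr r)) < 1 / 2) at_top"
    using eventually_gt_at_top by eventually_elim auto
  then obtain u where u: "u > 0" "exp (- (\<beta> powr r * u powr r)) < 1 / 2"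
    by (auto simp: eventually_at_top_linorder)
  show ?thesis
  proof (rule that[OF u(1)])
    fix q :: nat assume q: "q \<ge> 1"
    interpret P: prob_space "prior_measure r \<beta> q" by (rule prob_space_prior_measure[OF q assms])
    have "{b \<in> space (lebesgue_vec q). L2_set b {1..q} < u}
        = space (prior_measure r \<beta> q) - {b \<in> space (lebesgue_vec q). u \<le> L2_set b {1..q}}"
      by auto
    hence "P.prob {b \<in> space (lebesgue_vec q). L2_set b {1..q} < u}
        = 1 - P.prob {b \<in> space (lebesgue_vec q). u \<le> L2_set b {1..q}}"
      by (simp only:) (rule P.prob_compl, simp)
    also have "P.prob {b \<in> space (lebesgue_vec q). u \<le> L2_set b {1..q}} = exp (- (\<beta> powr r * u powr r))"
      by (simp add: measure_def thin_tail_prior_tail[OF q assms u(1)])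
    finally show "P.prob {b \<in> space (lebesgue_vec q). L2_set b {1..q} < u} \<ge> 1 / 2"
      using u(2) by simp
  qed
qed

text \<open>
  Lebesgue measure on a finite product is translation invariant because each factor is.
\<close>

lemma emeasure_L2_cball_translate:
  assumes "q \<ge> 1" "u \<ge> 0"
  shows "emeasure (lebesgue_vec q) {b \<in> space (lebesgue_vec q). L2_set (\<lambda>i. b i - c i) {1..q} \<le> u}
           = ennreal (unit_ball_vol (real q) * u ^ q)"
proof -
  interpret product_sigma_finite "\<lambda>_ :: nat. lborel :: real measure" ..
  let ?t = "\<lambda>b. \<lambda>i\<in>{1..q}. b i + c i"
  have t [measurable]: "?t \<in> measurable (lebesgue_vec q) (lebesgue_vec q)"
    by measurable
  have "distr (lebesgue_vec q) (lebesgue_vec q) ?t = lebesgue_vec q"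
  proof (rule PiM_eqI)
    fix A :: "nat \<Rightarrow> real set" assume A: "\<And>i. i \<in> {1..q} \<Longrightarrow> A i \<in> sets lborel"
    have "?t -` (\<Pi>\<^sub>E i\<in>{1..q}. A i) \<inter> space (lebesgue_vec q) = (\<Pi>\<^sub>E i\<in>{1..q}. (\<lambda>x. x + c i) -` A i)"
      by (auto simp: space_PiM PiE_iff)
    moreover have "(\<lambda>x. x + c i) -` A i \<in> sets lborel" if "i \<in> {1..q}" for i
      using measurable_sets[of "\<lambda>x. x + c i" lborel lborel "A i"] A[OF that] by simp
    moreover have "emeasure lborel ((\<lambda>x. x + c i) -` A i) = emeasure lborel (A i)" if "i \<in> {1..q}" for i
    proof -
      have shift: "(+) (c i) = (\<lambda>x. x + c i)" by (auto simp: fun_eq_iff)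
      have "emeasure lborel (A i) = emeasure (distr lborel borel ((+) (c i))) (A i)"
        by (simp add: lborel_distr_plus)
      also have "\<dots> = emeasure lborel ((\<lambda>x. x + c i) -` A i)"
        using A[OF that] by (subst emeasure_distr) (auto simp: shift)
      finally show ?thesis by simp
    qed
    ultimately show "emeasure (distr (lebesgue_vec q) (lebesgue_vec q) ?t) (\<Pi>\<^sub>E i\<in>{1..q}. A i)
        = (\<Prod>i\<in>{1..q}. emeasure lborel (A i))"
      using A by (subst emeasure_distr) (auto intro!: sets_PiM_I_finite trans[OF emeasure_PiM] prod.cong)
  qed auto
  hence "emeasure (lebesgue_vec q) {b \<in> space (lebesgue_vec q). L2_set (\<lambda>i. b i - c i) {1..q} \<le> u}
      = emeasure (distr (lebesgue_vec q) (lebesgue_vec q) ?t)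
          {b \<in> space (lebesgue_vec q). L2_set (\<lambda>i. b i - c i) {1..q} \<le> u}" by simp
  also have "\<dots> = emeasure (lebesgue_vec q) {b \<in> space (lebesgue_vec q). L2_set b {1..q} \<le> u}"
  proof (subst emeasure_distr)
    show "{b \<in> space (lebesgue_vec q). L2_set (\<lambda>i. b i - c i) {1..q} \<le> u} \<in> sets (lebesgue_vec q)"
      unfolding L2_set_def by measurable
    have "L2_set (\<lambda>i. ?t b i - c i) {1..q} = L2_set b {1..q}" for b
      by (rule L2_set_cong) auto
    thus "emeasure (lebesgue_vec q)
        (?t -` {b \<in> space (lebesgue_vec q). L2_set (\<lambda>i. b i - c i) {1..q} \<le> u} \<inter> space (lebesgue_vec q))
      = emeasure (lebesgue_vec q) {b \<in> space (lebesgue_vec q). L2_set b {1..q} \<le> u}"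
      using measurable_space[OF t] by (auto intro!: arg_cong[where f = "emeasure _"])
  qed auto
  finally show ?thesis using emeasure_L2_cball[OF assms] by simp
qed

text \<open>
  Since \<open>r \<le> q\<close>, the density is decreasing in the norm, so on a ball contained in the ball of
  radius \<open>K\<close> around the origin it is at least its value at norm \<open>K\<close>, except at the origin itself, where
  \<open>0 powr x = 0\<close>. The volume of the unit ball cancels against the sphere area up to the factor \<open>q\<close>.
\<close>

lemma prior_small_ball:
  assumes q: "q \<ge> 1" "r \<le> real q" and rb: "r > 0" "\<beta> > 0" and \<rho>: "\<rho> > 0"
    and K: "L2_set c {1..q} + \<rho> \<le> K"
  shows "measure (prior_measure r \<beta> q) {b \<in> space (lebesgue_vec q). L2_set (\<lambda>i. b i - c i) {1..q} \<le> \<rho>}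
           \<ge> r * \<beta> powr r * K powr r * exp (- (\<beta> powr r * K powr r)) * ((\<rho> / K) ^ q / real q)"
    (is "measure _ ?U \<ge> _")
proof -
  interpret P: prob_space "prior_measure r \<beta> q" by (rule prob_space_prior_measure[OF q(1) rb])
  have U [measurable]: "?U \<in> sets (lebesgue_vec q)" unfolding L2_set_def by measurable
  have K0: "K > 0" using K \<rho> L2_set_nonneg[of c "{1..q}"] by linarith
  define d where "d = r * K powr (r - real q) * \<beta> powr r * exp (- (\<beta> powr r * K powr r)) / sphere_area q"
  have V: "unit_ball_vol (real q) > 0" by simp
  hence S: "sphere_area q > 0" using q by (simp add: sphere_area_eq)
  have AE0: "AE b in lebesgue_vec q. L2_set b {1..q} \<noteq> 0"
  proof (rule AE_I)
    show "{b \<in> space (lebesgue_vec q). \<not> L2_set b {1..q} \<noteq> 0} \<subseteq> {b \<in> space (lebesgue_vec q). L2_set b {1..q} \<le> 0}"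
      by auto
    show "emeasure (lebesgue_vec q) {b \<in> space (lebesgue_vec q). L2_set b {1..q} \<le> 0} = 0"
      using q by (subst emeasure_L2_cball) (auto simp: power_0_left)
  qed measurable
  have lower: "d \<le> thin_tail_prior r \<beta> q b" if "b \<in> ?U" "L2_set b {1..q} \<noteq> 0" for b
  proof -
    have "L2_set b {1..q} = L2_set (\<lambda>i. (b i - c i) + c i) {1..q}" by simp
    also have "\<dots> \<le> L2_set (\<lambda>i. b i - c i) {1..q} + L2_set c {1..q}" by (rule L2_set_triangle_ineq)
    finally have bK: "L2_set b {1..q} \<le> K" using that K by simp
    have b0: "L2_set b {1..q} > 0" using that L2_set_nonneg[of b "{1..q}"] by linarith
    have "K powr (r - real q) \<le> L2_set b {1..q} powr (r - real q)"
      using b0 bK q by (intro powr_mono2') auto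
    moreover have "L2_set b {1..q} powr r \<le> K powr r" using b0 bK rb by (intro powr_mono2) auto
    hence "exp (- (\<beta> powr r * K powr r)) \<le> exp (- (\<beta> powr r * L2_set b {1..q} powr r))"
      by (simp add: mult_left_mono)
    ultimately show ?thesis using rb S unfolding d_def thin_tail_prior_def
      by (intro divide_right_mono mult_mono) auto
  qed
  have "ennreal d * emeasure (lebesgue_vec q) ?U = (\<integral>\<^sup>+b. ennreal d * indicator ?U b \<partial>lebesgue_vec q)"
    by (simp add: nn_integral_cmult_indicator)
  also have "\<dots> \<le> (\<integral>\<^sup>+b. ennreal (thin_tail_prior r \<beta> q b) * indicator ?U b \<partial>lebesgue_vec q)"
    using AE0 lower by (intro nn_integral_mono_AE) (auto simp: indicator_def intro!: ennreal_leI)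
  also have "\<dots> = emeasure (prior_measure r \<beta> q) ?U"
    unfolding prior_measure_def by (simp add: emeasure_density)
  also have "\<dots> = ennreal (measure (prior_measure r \<beta> q) ?U)" by (rule P.emeasure_eq_measure)
  finally have "ennreal (d * (unit_ball_vol (real q) * \<rho> ^ q)) \<le> ennreal (measure (prior_measure r \<beta> q) ?U)"
    using emeasure_L2_cball_translate[OF q(1), of \<rho> c] \<rho> V by (simp add: ennreal_mult'')
  hence "d * (unit_ball_vol (real q) * \<rho> ^ q) \<le> measure (prior_measure r \<beta> q) ?U"
    by (simp add: ennreal_le_iff)
  also have "d * (unit_ball_vol (real q) * \<rho> ^ q)
      = r * \<beta> powr r * K powr r * exp (- (\<beta> powr r * K powr r)) * ((\<rho> / K) ^ q / real q)"
    using K0 q less_imp_neq[OF V, symmetric] unfolding d_def sphere_area_eq[OF q(1)]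
    by (simp add: powr_diff powr_realpow power_divide field_simps)
  finally show ?thesis .
qed

section \<open>Bounding the quasi-posterior\<close>

lemma abs_le_L2_set: "i \<in> {1..q :: nat} \<Longrightarrow> \<bar>b i\<bar> \<le> L2_set b {1..q}"
  using member_le_L2_set[of "{1..q}" i "\<lambda>i. \<bar>b i\<bar>", OF finite_atLeastAtMost] by (simp add: L2_set_def)

lemma G_bar_nonneg: "G_bar rho n k s g \<ge> 0"
  unfolding G_bar_def v_hat_def by (intro sum_nonneg divide_nonneg_nonneg)
    (auto intro!: sum_nonneg divide_nonneg_nonneg)

lemma measurable_G_bar:
  assumes "\<And>z. z \<in> space S \<Longrightarrow> (\<lambda>b. rho z (sieve_elem phi q b)) \<in> borel_measurable (lebesgue_vec q)"
    and "\<And>i. fst (s i) \<in> space S"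
  shows "(\<lambda>b. G_bar rho n k s (sieve_elem phi q b)) \<in> borel_measurable (lebesgue_vec q)"
proof -
  note [measurable] = assms(1)[OF assms(2)]
  show ?thesis unfolding G_bar_def m_bar_def by measurable
qed

text \<open>
  The function space need not be second countable, so measurability cannot be assembled from sums and
  scalar multiples of vector-valued functions. Instead, the composition is continuous in the product
  topology on \<open>nat \<Rightarrow> real\<close>, whose Borel sets are the product sets.
\<close>

lemma measurable_continuous_sieve:
  fixes phi :: "nat \<Rightarrow> 'h::real_normed_vector" and f :: "'h \<Rightarrow> real"
  assumes f: "continuous_on UNIV f"
  shows "(\<lambda>b. f (sieve_elem phi q b)) \<in> borel_measurable (lebesgue_vec q)"
proof -
  have cont: "continuous_on UNIV (\<lambda>b :: nat \<Rightarrow> real. f (sieve_elem phi q b))"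
    unfolding sieve_elem_def
    by (intro continuous_on_compose2[OF f] continuous_on_sum continuous_on_scaleR) auto
  have "(\<lambda>b. f (sieve_elem phi q b)) \<in> borel_measurable (\<Pi>\<^sub>M i\<in>(UNIV :: nat set). borel)"
    using borel_measurable_continuous_onI[OF cont]
      measurable_cong_sets[OF sets_PiM_equal_borel refl] by blast
  moreover have "(\<lambda>b i. if i \<in> {1..q} then b i else 0) \<in> measurable (lebesgue_vec q) (\<Pi>\<^sub>M i\<in>(UNIV :: nat set). borel)"
  proof (rule measurable_PiM_single')
    show "(\<lambda>b. if i \<in> {1..q} then b i else 0) \<in> borel_measurable (lebesgue_vec q)" for i
      by (cases "i \<in> {1..q}") auto
  qed auto
  ultimately have "(\<lambda>b. f (sieve_elem phi q (\<lambda>i. if i \<in> {1..q} then b i else 0)))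
      \<in> borel_measurable (lebesgue_vec q)"
    by (rule measurable_compose[rotated])
  moreover have "sieve_elem phi q (\<lambda>i. if i \<in> {1..q} then b i else 0) = sieve_elem phi q b" for b
    unfolding sieve_elem_def by (rule sum.cong) auto
  ultimately show ?thesis by simp
qed

lemma sieve_elem_in_space: "sieve_elem phi q b \<in> sieve_space phi q"
  unfolding sieve_elem_def sieve_space_def
  by (intro span_sum span_scale span_base) auto

text \<open>
  The posterior mass of the complement is a quotient of two integrals against the prior. Where the
  coefficients leave the box, the likelihood is bounded by one and the prior tail is used; the
  denominator is reduced to the set \<open>U\<close>.
\<close>

lemma posterior_deviation_bound:
  fixes phi :: "nat \<Rightarrow> 'h::real_normed_vector"
  assumes q: "q \<ge> 1" and rb: "r > 0" "\<beta> > 0" and B: "B > 0"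
    and rho: "\<And>z. z \<in> space S \<Longrightarrow> (\<lambda>b. rho z (sieve_elem phi q b)) \<in> borel_measurable (lebesgue_vec q)"
    and s: "\<And>i. fst (s i) \<in> space S"
    and good: "\<And>b. \<forall>i\<in>{1..q}. \<bar>b i\<bar> \<le> B \<Longrightarrow> sieve_elem phi q b \<notin> enlargement T \<epsilon> \<Longrightarrow>
        G_bar rho n k s (sieve_elem phi q b) \<ge> a"
    and U [measurable]: "U \<in> sets (lebesgue_vec q)"
    and low: "\<And>b. b \<in> U \<Longrightarrow> G_bar rho n k s (sieve_elem phi q b) \<le> c"
    and p: "p > 0" "measure (prior_measure r \<beta> q) U \<ge> p"
  shows "\<bar>posterior_prob rho phi r \<beta> q n k s (enlargement T \<epsilon>) - 1\<bar>
     \<le> (exp (- (real n / 2 * a)) + exp (- (\<beta> powr r * B powr r))) / (exp (- (real n / 2 * c)) * p)"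
proof -
  let ?G = "\<lambda>b. G_bar rho n k s (sieve_elem phi q b)"
  let ?A = "{b \<in> space (lebesgue_vec q). sieve_elem phi q b \<in> enlargement T \<epsilon>}"
  let ?E = "\<lambda>b. ennreal (exp (- (real n / 2) * ?G b))"
  let ?T = "{b \<in> space (lebesgue_vec q). B \<le> L2_set b {1..q}}"
  interpret Pr: prob_space "prior_measure r \<beta> q" by (rule prob_space_prior_measure[OF q rb])
  have G [measurable]: "?G \<in> borel_measurable (lebesgue_vec q)"
    by (rule measurable_G_bar[OF rho s])
  have "(\<lambda>b. infdist (sieve_elem phi q b) T) \<in> borel_measurable (lebesgue_vec q)"
    by (rule measurable_continuous_sieve) (intro continuous_intros)
  hence A [measurable]: "?A \<in> sets (lebesgue_vec q)"
    unfolding enlargement_def mem_Collect_eq by measurable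
  have T [measurable]: "?T \<in> sets (lebesgue_vec q)" by measurable
  define \<nu> where "\<nu> = unnormalized_posterior rho phi r \<beta> q n k s"
  have prior_nn: "thin_tail_prior r \<beta> q b \<ge> 0" for b
    using rb q by (auto simp: thin_tail_prior_def sphere_area_eq)
  have \<nu>: "\<nu> = density (prior_measure r \<beta> q) ?E"
    unfolding \<nu>_def unnormalized_posterior_def prior_measure_def
    by (subst density_density_eq) (auto simp: ennreal_mult'[OF prior_nn])
  have sets_\<nu> [measurable_cong, simp]: "sets \<nu> = sets (lebesgue_vec q)" by (simp add: \<nu>)
  have space_\<nu> [simp]: "space \<nu> = space (lebesgue_vec q)" by (simp add: \<nu>)
  have em: "emeasure \<nu> D = (\<integral>\<^sup>+b. ?E b * indicator D b \<partial>prior_measure r \<beta> q)"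
    if "D \<in> sets (lebesgue_vec q)" for D
    unfolding \<nu> using that by (subst emeasure_density) auto
  have E1: "?E b \<le> 1" for b
    using G_bar_nonneg[of rho n k s] by simp
  have "emeasure \<nu> (space \<nu>) \<le> (\<integral>\<^sup>+b. 1 \<partial>prior_measure r \<beta> q)"
    using E1 by (subst em, simp, intro nn_integral_mono) (auto simp: indicator_def)
  also have "\<dots> = 1" by (simp add: Pr.emeasure_space_1[simplified])
  finally have fin: "emeasure \<nu> (space \<nu>) \<le> 1" .
  interpret \<nu>: finite_measure \<nu>
    by (rule finite_measureI) (use fin in \<open>auto simp: top_unique\<close>)
  have num: "measure \<nu> (space \<nu> - ?A) \<le> exp (- (real n / 2 * a)) + exp (- (\<beta> powr r * B powr r))"
  proof -
    have "emeasure \<nu> (space \<nu> - ?A)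
        = (\<integral>\<^sup>+b. ?E b * indicator (space \<nu> - ?A) b \<partial>prior_measure r \<beta> q)"
      by (rule em) simp
    also have "\<dots> \<le> (\<integral>\<^sup>+b. (ennreal (exp (- (real n / 2 * a))) + indicator ?T b) \<partial>prior_measure r \<beta> q)"
    proof (rule nn_integral_mono)
      fix b assume b: "b \<in> space (prior_measure r \<beta> q)"
      show "?E b * indicator (space \<nu> - ?A) b \<le> ennreal (exp (- (real n / 2 * a))) + indicator ?T b"
      proof (cases "b \<in> space \<nu> - ?A \<and> b \<notin> ?T")
        case True
        have "\<bar>b i\<bar> \<le> B" if "i \<in> {1..q}" for i
          using abs_le_L2_set[OF that, of b] b True by auto
        hence "?G b \<ge> a" using True by (intro good) auto
        hence "?E b \<le> ennreal (exp (- (real n / 2 * a)))"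
          by (intro ennreal_leI) (simp add: mult_left_mono)
        thus ?thesis using True by (simp add: indicator_def)
      next
        case False
        show ?thesis
        proof (cases "b \<in> space \<nu> - ?A")
          case True
          with False have "indicator ?T b = (1 :: ennreal)" by simp
          moreover have "?E b * indicator (space \<nu> - ?A) b = ?E b" using True by simp
          ultimately show ?thesis using add_increasing[of "ennreal (exp (- (real n / 2 * a)))", OF zero_le E1[of b]]
            by (simp only:)
        next
          case False
          hence "?E b * indicator (space \<nu> - ?A) b = 0" by (simp del: space_\<nu>)
          thus ?thesis by (simp only: zero_le)
        qed
      qed
    qed
    also have "\<dots> = ennreal (exp (- (real n / 2 * a))) + emeasure (prior_measure r \<beta> q) ?T"
      by (subst nn_integral_add) (auto simp: Pr.emeasure_space_1[simplified])
    also have "emeasure (prior_measure r \<beta> q) ?T = ennreal (exp (- (\<beta> powr r * B powr r)))"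
      by (rule thin_tail_prior_tail[OF q rb B])
    finally have "ennreal (measure \<nu> (space \<nu> - ?A))
        \<le> ennreal (exp (- (real n / 2 * a)) + exp (- (\<beta> powr r * B powr r)))"
      by (simp add: \<nu>.emeasure_eq_measure)
    thus ?thesis by (rule ennreal_le_iff[THEN iffD1, rotated]) (simp add: add_nonneg_nonneg)
  qed
  have den: "exp (- (real n / 2 * c)) * p \<le> measure \<nu> (space \<nu>)"
  proof -
    have "ennreal (exp (- (real n / 2 * c)) * p)
        \<le> ennreal (exp (- (real n / 2 * c))) * emeasure (prior_measure r \<beta> q) U"
      using p by (simp add: ennreal_mult' Pr.emeasure_eq_measure mult_left_mono)
    also have "\<dots> = (\<integral>\<^sup>+b. ennreal (exp (- (real n / 2 * c))) * indicator U b \<partial>prior_measure r \<beta> q)"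
      by (simp add: nn_integral_cmult_indicator)
    also have "\<dots> \<le> (\<integral>\<^sup>+b. ?E b * indicator U b \<partial>prior_measure r \<beta> q)"
      using low by (intro nn_integral_mono) (auto simp: indicator_def mult_left_mono intro!: ennreal_leI)
    also have "\<dots> = emeasure \<nu> U" by (simp add: em)
    also have "\<dots> \<le> emeasure \<nu> (space \<nu>)" by (rule emeasure_space)
    finally show ?thesis by (simp add: \<nu>.emeasure_eq_measure)
  qed
  have pos: "exp (- (real n / 2 * c)) * p > 0" using p by simp
  have "posterior_prob rho phi r \<beta> q n k s (enlargement T \<epsilon>) = measure \<nu> ?A / measure \<nu> (space \<nu>)"
    by (simp add: posterior_prob_def \<nu>_def[symmetric])
  also have "measure \<nu> ?A = measure \<nu> (space \<nu>) - measure \<nu> (space \<nu> - ?A)"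
    by (subst \<nu>.finite_measure_compl) auto
  finally have "posterior_prob rho phi r \<beta> q n k s (enlargement T \<epsilon>) - 1
      = - (measure \<nu> (space \<nu> - ?A) / measure \<nu> (space \<nu>))"
    using pos den by (simp add: diff_divide_distrib)
  hence "\<bar>posterior_prob rho phi r \<beta> q n k s (enlargement T \<epsilon>) - 1\<bar>
      = measure \<nu> (space \<nu> - ?A) / measure \<nu> (space \<nu>)"
    by (simp only: abs_minus_cancel) (simp add: measure_nonneg)
  also have "\<dots> \<le> (exp (- (real n / 2 * a)) + exp (- (\<beta> powr r * B powr r))) / (exp (- (real n / 2 * c)) * p)"
    using num den pos by (intro frac_le) auto
  finally show ?thesis .
qed

section \<open>Concentration\<close>

lemma sieve_box_memI: "(\<And>i. i \<in> {1..q} \<Longrightarrow> \<bar>b i\<bar> \<le> B) \<Longrightarrow> sieve_elem phi q b \<in> sieve_box phi q B"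
  unfolding sieve_box_def by blast

lemma gamma_bound_upper:
  assumes "g \<in> F" "w \<in> cbox 0 1"
  shows "ereal \<bar>m g w\<bar> \<le> gamma_bound m F"
proof -
  have "ereal \<bar>m g w\<bar> \<le> (SUP g\<in>F. SUP w\<in>cbox 0 1. ereal \<bar>m g w\<bar>)"
    using assms by (intro SUP_upper2[of g] SUP_upper2[of w]) auto
  also have "\<dots> \<le> gamma_bound m F" by (simp add: gamma_bound_def ereal_le_add_self)
  finally show ?thesis .
qed

lemma gamma_bound_ge_1:
  fixes m :: "'h \<Rightarrow> real^'d \<Rightarrow> real"
  assumes "g \<in> F"
  shows "1 \<le> gamma_bound m F"
proof -
  have "(0 :: real^'d) \<in> cbox 0 1" by (simp add: mem_box_cart)
  hence "0 \<le> (SUP g\<in>F. SUP w\<in>cbox 0 1. ereal \<bar>m g w\<bar>)"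
    using assms by (intro SUP_upper2[of g] SUP_upper2[of 0]) auto
  thus ?thesis unfolding gamma_bound_def by (metis add_0 add_right_mono)
qed

text \<open>
  The lower bound for the posterior normalisation rests on a set \<open>U\<close> of coefficients that is small enough
  for the criterion and large enough for the prior. With \<open>\<gamma>\<close> a bound on the conditional means, \<open>\<gamma> * t \<le> L * R\<close> says that the criterion moves by \<open>O(R)\<close> on
  \<open>U\<close>. The constants \<open>p\<close> and \<open>L\<close> are uniform in the dimension and the sample size.
\<close>

lemma prior_mass_near_sieve_approximation:
  assumes rb: "r > 0" "\<beta> > 0" and \<kappa>: "\<kappa> \<ge> 0"
  obtains p L where "p > 0" "L \<ge> 0"
    "\<And>q n \<Lambda> \<gamma> R c. \<lbrakk>q \<ge> 1; r \<le> real q; \<Lambda> > 0; \<Lambda> \<le> R; \<gamma> \<ge> 1;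
        \<gamma> * exp (- (real n * \<Lambda> / real q)) \<le> R; L2_set c {1..q} \<le> \<kappa>\<rbrakk> \<Longrightarrow>
      \<exists>U t. U \<in> sets (lebesgue_vec q) \<and> t > 0 \<and> \<gamma> * t \<le> L * R \<and>
        (\<forall>b\<in>U. L2_set (\<lambda>i. b i - c i) {1..q} \<le> t \<and> L2_set b {1..q} \<le> L) \<and>
        measure (prior_measure r \<beta> q) U \<ge> p * exp (- (L * (real n * R)))"
proof -
  obtain u where u: "u > 0" and half: "\<And>q. q \<ge> 1 \<Longrightarrow>
      measure (prior_measure r \<beta> q) {b \<in> space (lebesgue_vec q). L2_set b {1..q} < u} \<ge> 1 / 2"
    using prior_half_ball[OF rb] by blast
  define K where "K = \<kappa> + 1"
  have K: "K \<ge> 1" using \<kappa> by (simp add: K_def)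
  define A where "A = r * \<beta> powr r * K powr r * exp (- (\<beta> powr r * K powr r))"
  have A: "A > 0" using rb K by (simp add: A_def)
  define p where "p = min A (1 / 2)"
  define L where "L = 2 + ln K + exp 1 * (u + \<kappa>) + K + u"
  have lnK: "ln K \<ge> 0" using K by simp
  have e0: "exp 1 * (u + \<kappa>) \<ge> 0" using u \<kappa> by simp
  have L: "L \<ge> 2 + ln K" "L \<ge> K" "L \<ge> u" "L \<ge> exp 1 * (u + \<kappa>)" "L \<ge> 1" "L \<ge> 0"
    using lnK K u \<kappa> e0 unfolding L_def by linarith+
  show ?thesis
  proof (rule that[of p L])
    show "p > 0" "L \<ge> 0" using A L by (auto simp: p_def)
    fix q n :: nat and \<Lambda> \<gamma> R :: real and c :: "nat \<Rightarrow> real"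
    assume q: "q \<ge> 1" "r \<le> real q" and \<Lambda>: "\<Lambda> > 0" "\<Lambda> \<le> R" and \<gamma>: "\<gamma> \<ge> 1"
      and \<gamma>R: "\<gamma> * exp (- (real n * \<Lambda> / real q)) \<le> R" and c: "L2_set c {1..q} \<le> \<kappa>"
    have R: "R > 0" using \<Lambda> by simp
    show "\<exists>U t. U \<in> sets (lebesgue_vec q) \<and> t > 0 \<and> \<gamma> * t \<le> L * R \<and>
        (\<forall>b\<in>U. L2_set (\<lambda>i. b i - c i) {1..q} \<le> t \<and> L2_set b {1..q} \<le> L) \<and>
        measure (prior_measure r \<beta> q) U \<ge> p * exp (- (L * (real n * R)))"
    proof (cases "real n * \<Lambda> \<ge> real q")
      \<comment> \<open>A factor \<open>exp (O(q))\<close> is absorbed by \<open>exp (O(n * \<Lambda>))\<close>, so a small ball around \<open>c\<close> has enough mass.\<close>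
      case True
      define t where "t = exp (- (real n * \<Lambda> / real q))"
      have t: "t > 0" "t \<le> 1" using \<Lambda> by (auto simp: t_def)
      define U where "U = {b \<in> space (lebesgue_vec q). L2_set (\<lambda>i. b i - c i) {1..q} \<le> t}"
      have "U \<in> sets (lebesgue_vec q)" unfolding U_def L2_set_def by measurable
      moreover have "\<gamma> * t \<le> L * R"
        using \<gamma>R order_trans[OF _ mult_right_mono[OF L(5), of R]] R by (simp add: t_def)
      moreover have "L2_set b {1..q} \<le> L" if "b \<in> U" for b
      proof -
        have "L2_set b {1..q} = L2_set (\<lambda>i. (b i - c i) + c i) {1..q}" by simp
        also have "\<dots> \<le> L2_set (\<lambda>i. b i - c i) {1..q} + L2_set c {1..q}" by (rule L2_set_triangle_ineq)
        also have "\<dots> \<le> K" using that c t by (simp add: U_def K_def)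
        finally show ?thesis using L by simp
      qed
      moreover have "p * exp (- (L * (real n * R))) \<le> measure (prior_measure r \<beta> q) U"
      proof -
        have "exp (- (L * (real n * R))) \<le> exp (- (real n * \<Lambda>) - real q * ln K - real q)"
        proof -
          have "real n * \<Lambda> \<le> real n * R" using \<Lambda> by (intro mult_left_mono) auto
          hence "(2 + ln K) * (real n * \<Lambda>) \<le> L * (real n * R)"
            using L lnK \<Lambda> by (intro mult_mono) auto
          moreover have "real q * (1 + ln K) \<le> (real n * \<Lambda>) * (1 + ln K)"
            using True lnK by (intro mult_right_mono) auto
          ultimately show ?thesis by (simp add: algebra_simps)
        qed
        also have "\<dots> = (t / K) ^ q * exp (- real q)"
        proof -
          have "t ^ q = exp (- (real n * \<Lambda>))"
            using q by (simp add: t_def exp_of_nat_mult[symmetric])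
          moreover have "K ^ q = exp (real q * ln K)" using K by (simp add: exp_of_nat_mult)
          ultimately show ?thesis by (simp add: power_divide exp_diff exp_minus exp_add field_simps)
        qed
        also have "\<dots> \<le> (t / K) ^ q / real q"
        proof -
          have "real q \<le> exp (real q)" using exp_ge_add_one_self[of "real q"] by linarith
          hence "exp (- real q) \<le> 1 / real q" using q by (simp add: exp_minus field_simps)
          thus ?thesis using mult_left_mono[of "exp (- real q)" "1 / real q" "(t / K) ^ q"] t K by simp
        qed
        finally have "p * exp (- (L * (real n * R))) \<le> A * ((t / K) ^ q / real q)"
          using A by (intro mult_mono) (auto simp: p_def)
        also have "\<dots> \<le> measure (prior_measure r \<beta> q) U"
          unfolding A_def U_def using c t by (intro prior_small_ball q rb) (auto simp: K_def)
        finally show ?thesis .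
      qed
      ultimately show ?thesis using t by (intro exI[of _ U] exI[of _ t]) (auto simp: U_def)
    next
      \<comment> \<open>Now \<open>\<gamma> \<le> exp 1 * R\<close>, so \<open>t\<close> may be a constant and no smallness of the ball is needed.\<close>
      case False
      define U where "U = {b \<in> space (lebesgue_vec q). L2_set b {1..q} < u}"
      have "U \<in> sets (lebesgue_vec q)" unfolding U_def by measurable
      moreover have "\<gamma> * (u + \<kappa>) \<le> L * R"
      proof -
        have "exp (- 1) \<le> exp (- (real n * \<Lambda> / real q))"
          using False q by (simp add: divide_simps)
        hence "\<gamma> * exp (- 1) \<le> \<gamma> * exp (- (real n * \<Lambda> / real q))" using \<gamma> by (intro mult_left_mono) auto
        hence "\<gamma> * exp (- 1) \<le> R" using \<gamma>R by (rule order_trans)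
        hence "\<gamma> \<le> exp 1 * R" by (simp add: exp_minus field_simps)
        hence "\<gamma> * (u + \<kappa>) \<le> (exp 1 * R) * (u + \<kappa>)" using u \<kappa> by (intro mult_right_mono) auto
        also have "\<dots> \<le> L * R" using L(4) R mult_right_mono[of "exp 1 * (u + \<kappa>)" L R]
          by (simp add: mult_ac)
        finally show ?thesis .
      qed
      moreover have "L2_set (\<lambda>i. b i - c i) {1..q} \<le> u + \<kappa>" if "b \<in> U" for b
      proof -
        have "L2_set (\<lambda>i. b i + - c i) {1..q} \<le> L2_set b {1..q} + L2_set (\<lambda>i. - c i) {1..q}"
          by (rule L2_set_triangle_ineq)
        also have "L2_set (\<lambda>i. - c i) {1..q} = L2_set c {1..q}" by (simp add: L2_set_def)
        finally show ?thesis using that c by (simp add: U_def)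
      qed
      moreover have "p * exp (- (L * (real n * R))) \<le> measure (prior_measure r \<beta> q) U"
      proof -
        have "p * exp (- (L * (real n * R))) \<le> (1 / 2) * 1"
          using L R A by (intro mult_mono) (auto simp: p_def)
        thus ?thesis using half[OF q(1)] by (simp add: U_def)
      qed
      ultimately show ?thesis using u \<kappa> L by (intro exI[of _ U] exI[of _ "u + \<kappa>"]) (auto simp: U_def)
    qed
  qed
qed

text \<open>
  The exponents are matched here. On \<open>U\<close> the denominator costs \<open>exp (- Q * (n * R))\<close>, where \<open>Q\<close>
  collects the likelihood and the prior mass. The separation constant \<open>K + 2 * Q + 2\<close> is the one for
  which, after the loss \<open>K * R\<close> from replacing \<open>J\<close> by its empirical version, the numerator is at most
  \<open>exp (- (Q + 1) * (n * R))\<close>; the tail condition gives the same bound outside the box.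
\<close>

lemma posterior_concentration_bound:
  fixes phi :: "nat \<Rightarrow> 'h::real_normed_vector"
  assumes q: "q \<ge> 1" and rb: "r > 0" "\<beta> > 0" and B: "B > 0"
    and rho: "\<And>z. z \<in> space S \<Longrightarrow> (\<lambda>b. rho z (sieve_elem phi q b)) \<in> borel_measurable (lebesgue_vec q)"
    and s: "\<And>i. fst (s i) \<in> space S"
    and unif: "\<And>g. g \<in> sieve_box phi q B \<Longrightarrow> \<bar>ereal (G_bar rho n k s g) - J g\<bar> \<le> ereal (K * R)"
    and U: "U \<in> sets (lebesgue_vec q)" "\<And>b i. b \<in> U \<Longrightarrow> i \<in> {1..q} \<Longrightarrow> \<bar>b i\<bar> \<le> B"
    and JU: "\<And>b. b \<in> U \<Longrightarrow> J (sieve_elem phi q b) \<le> ereal (c * R)"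
    and p: "p > 0" "measure (prior_measure r \<beta> q) U \<ge> p * exp (- (L * (real n * R)))"
    and Q: "Q = (c + K) / 2 + L"
    and sep: "\<And>g. g \<in> sieve_space phi q \<Longrightarrow> g \<notin> enlargement T \<epsilon> \<Longrightarrow> ereal ((K + 2 * Q + 2) * R) \<le> J g"
    and tail: "(Q + 1) * (real n * R) \<le> \<beta> powr r * B powr r"
  shows "\<bar>posterior_prob rho phi r \<beta> q n k s (enlargement T \<epsilon>) - 1\<bar> \<le> 2 / p * exp (- (real n * R))"
proof -
  have close: "ereal (G_bar rho n k s g) \<le> J g + ereal (K * R)" "J g \<le> ereal (G_bar rho n k s g + K * R)"
    if "g \<in> sieve_box phi q B" for g
    using unif[OF that] by (cases "J g"; auto)+
  have "\<bar>posterior_prob rho phi r \<beta> q n k s (enlargement T \<epsilon>) - 1\<bar>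
     \<le> (exp (- (real n / 2 * ((2 * Q + 2) * R))) + exp (- (\<beta> powr r * B powr r)))
         / (exp (- (real n / 2 * ((c + K) * R))) * (p * exp (- (L * (real n * R)))))"
  proof (rule posterior_deviation_bound[OF q rb B rho s _ U(1) _ _ p(2)])
    fix b assume b: "\<forall>i\<in>{1..q}. \<bar>b i\<bar> \<le> B" "sieve_elem phi q b \<notin> enlargement T \<epsilon>"
    have "ereal ((K + 2 * Q + 2) * R) \<le> ereal (G_bar rho n k s (sieve_elem phi q b) + K * R)"
      using sep[OF sieve_elem_in_space b(2)] close(2)[OF sieve_box_memI[of q b B phi]] b(1) order_trans by blast
    thus "(2 * Q + 2) * R \<le> G_bar rho n k s (sieve_elem phi q b)" by (simp add: algebra_simps)
  next
    fix b assume b: "b \<in> U"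
    have "ereal (G_bar rho n k s (sieve_elem phi q b)) \<le> J (sieve_elem phi q b) + ereal (K * R)"
      using U(2)[OF b] by (intro close sieve_box_memI) auto
    also have "\<dots> \<le> ereal (c * R) + ereal (K * R)" by (intro add_right_mono JU b)
    finally show "G_bar rho n k s (sieve_elem phi q b) \<le> (c + K) * R" by (simp add: algebra_simps)
  qed (use p in auto)
  also have "\<dots> \<le> (2 * exp (- ((Q + 1) * (real n * R)))) / (p * exp (- (Q * (real n * R))))"
  proof (rule frac_le)
    have "real n / 2 * ((2 * Q + 2) * R) = (Q + 1) * (real n * R)" by (simp add: field_simps)
    moreover have "exp (- (\<beta> powr r * B powr r)) \<le> exp (- ((Q + 1) * (real n * R)))"
      using tail by simp
    ultimately show "exp (- (real n / 2 * ((2 * Q + 2) * R))) + exp (- (\<beta> powr r * B powr r))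
        \<le> 2 * exp (- ((Q + 1) * (real n * R)))"
      by (simp only:)
    have "- (real n / 2 * ((c + K) * R)) + - (L * (real n * R)) = - (Q * (real n * R))"
      unfolding Q by (simp add: field_simps)
    hence "exp (- (real n / 2 * ((c + K) * R))) * exp (- (L * (real n * R))) = exp (- (Q * (real n * R)))"
      by (simp only: exp_add[symmetric])
    thus "p * exp (- (Q * (real n * R)))
        \<le> exp (- (real n / 2 * ((c + K) * R))) * (p * exp (- (L * (real n * R))))"
      by (simp add: mult_ac)
  qed (use p in auto)
  also have "exp (- ((Q + 1) * (real n * R))) = exp (- (real n * R)) * exp (- (Q * (real n * R)))"
    by (simp add: exp_add[symmetric] algebra_simps)
  also have "2 * (exp (- (real n * R)) * exp (- (Q * (real n * R)))) / (p * exp (- (Q * (real n * R))))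
      = 2 / p * exp (- (real n * R))"
    by simp
  finally show ?thesis .
qed

theorem theorem3p4:
  fixes M :: "'o measure"
    and S :: "'z measure"
    and P :: "('z \<times> (real^'d)) measure"
    and D :: "nat \<Rightarrow> 'o \<Rightarrow> 'z \<times> (real^'d)"
    and SX :: "'x measure"
    and X :: "'z \<times> (real^'d) \<Rightarrow> 'x"
    and evl :: "'h::banach \<Rightarrow> 'x \<Rightarrow> real"
    and rho :: "'z \<Rightarrow> 'h \<Rightarrow> real"
    and m :: "'h \<Rightarrow> real^'d \<Rightarrow> real"
    and phi :: "nat \<Rightarrow> 'h"
    and q k :: "nat \<Rightarrow> nat"
    and r \<beta> :: real
    and lam B :: "nat \<Rightarrow> real"
    and g0 :: 'h
    and b_star :: "nat \<Rightarrow> nat \<Rightarrow> real"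
    and g_star :: "nat \<Rightarrow> 'h"
  assumes prob_space: "prob_space M"
    and sets_P: "sets P = sets (S \<Otimes>\<^sub>M borel)"
    and W_range: "AE y in P. snd y \<in> cbox 0 1"
    and covariate: "X \<in> measurable P SX"
    and function_sp: "function_space P SX X evl"
    and infinite_dim: "\<not> (\<exists>A :: 'h set. finite A \<and> span A = UNIV)"
    and rho_integrable: "\<And>g. integrable P (\<lambda>y. rho (fst y) g)"
    and rho_measurable: "\<And>n z. z \<in> space S \<Longrightarrow>
          (\<lambda>b. rho z (sieve_elem phi (q n) b)) \<in> borel_measurable (\<Pi>\<^sub>M i\<in>{1..q n}. lborel)"
    and cond_mean: "cond_mean_version P rho m"
    and identified_nonempty: "identified_region P m \<noteq> {}"
    and q_at_top: "filterlim q at_top sequentially"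
    and sieve_dense: "closure (\<Union>n. sieve_space phi (q n)) = UNIV"
    and k_at_top: "filterlim k at_top sequentially"
    and prior_params: "r > 0" "\<beta> > 0"
    and A1_indep: "prob_space.indep_vars M (\<lambda>_. P) D UNIV"
    and A1_ident: "\<And>i. distr M P (D i) = P"
    and B_at_top: "filterlim B at_top sequentially"
    and A2_lam: "\<And>n. lam n > 0" "lam \<longlonglongrightarrow> 0"
    and A2: "bigo_in_prob M
          (\<lambda>n \<omega>. SUP g\<in>sieve_box phi (q n) (B n).
             \<bar>ereal (G_bar rho n (k n) (\<lambda>i. D i \<omega>) g) - moment_crit P m g\<bar>) lam"
    and A3_orthonormal: "\<And>i j. 1 \<le> i \<Longrightarrow> 1 \<le> j \<Longrightarrow>
          (\<integral>y. evl (phi i) (X y) * evl (phi j) (X y) \<partial>P) = (if i = j then 1 else 0)"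
    and A3_g0: "g0 \<in> identified_region P m"
    and A3_g_star: "\<And>n. g_star n = sieve_elem phi (q n) (b_star n)"
    and A3_approx: "(\<lambda>n. norm (g_star n - g0)) \<longlonglongrightarrow> 0"
    and b_star_bounded: "\<exists>K. \<forall>n. (\<Sum>i=1..q n. (b_star n i)\<^sup>2) \<le> K"
    and A4: "\<exists>C>0. \<forall>g1 g2.
          (\<integral>\<^sup>+ y. ennreal \<bar>rho (fst y) g1 - rho (fst y) g2\<bar> \<partial>P)
            \<le> ennreal C * (\<integral>\<^sup>+ y. ennreal \<bar>evl g1 (X y) - evl g2 (X y)\<bar> \<partial>P)"
    and rate_prior: "ereal_smallo (rate P m phi q g_star B lam)
          (\<lambda>n. ereal (B n powr r / real n))"
    and rate_separation: "\<And>\<epsilon>. \<epsilon> > 0 \<Longrightarrow>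
          ereal_smallo (rate P m phi q g_star B lam)
            (\<lambda>n. INF g\<in>sieve_space phi (q n) - enlargement (identified_region P m) \<epsilon>.
                    moment_crit P m g)"
  shows "\<forall>\<epsilon>>0. tendsto_in_prob M
          (\<lambda>n \<omega>. posterior_prob rho phi r \<beta> (q n) n (k n) (\<lambda>i. D i \<omega>)
                    (enlargement (identified_region P m) \<epsilon>)) 1"
proof (intro allI impI)
  fix \<epsilon> :: real assume \<epsilon>: "\<epsilon> > 0"
  let ?T = "identified_region P m"
  let ?post = "\<lambda>n \<omega>. posterior_prob rho phi r \<beta> (q n) n (k n) (\<lambda>i. D i \<omega>) (enlargement ?T \<epsilon>)"
  interpret M: prob_space M by (rule prob_space)
  have D: "D i \<in> measurable M P" for i using A1_indep by (auto simp: M.indep_vars_def)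
  have P: "prob_space P" using M.prob_space_distr[OF D[of 0]] by (simp add: A1_ident)
  have fst_D: "fst (D i \<omega>) \<in> space S" if "\<omega> \<in> space M" for i \<omega>
    using measurable_space[OF D that, of i] sets_eq_imp_space_eq[OF sets_P] by (auto simp: space_pair_measure)
  have snd_P: "snd \<in> measurable P borel" using sets_P by (simp cong: measurable_cong_sets)
  have m_meas: "m g \<in> borel_measurable borel" for g
    using cond_mean by (simp add: cond_mean_version_def)
  obtain C where C: "C > 0" and lip: "\<And>g1 g2. (\<integral>\<^sup>+ y. ennreal \<bar>rho (fst y) g1 - rho (fst y) g2\<bar> \<partial>P)
            \<le> ennreal C * (\<integral>\<^sup>+ y. ennreal \<bar>evl g1 (X y) - evl g2 (X y)\<bar> \<partial>P)"
    using A4 by blast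
  obtain K0 where K0: "\<And>n. (\<Sum>i=1..q n. (b_star n i)\<^sup>2) \<le> K0" using b_star_bounded by blast
  define \<kappa> where "\<kappa> = sqrt K0"
  have "K0 \<ge> 0" using K0[of 0] sum_nonneg[of "{1..q 0}" "\<lambda>i. (b_star 0 i)\<^sup>2"] by simp
  hence \<kappa>: "\<kappa> \<ge> 0" and b\<kappa>: "L2_set (b_star n) {1..q n} \<le> \<kappa>" for n
    using K0[of n] by (auto simp: \<kappa>_def L2_set_def)
  obtain p L where p: "p > 0" and L: "L \<ge> 0" and mass: "\<And>q n \<Lambda> \<gamma> R c. \<lbrakk>q \<ge> 1; r \<le> real q; \<Lambda> > 0; \<Lambda> \<le> R; \<gamma> \<ge> 1;
        \<gamma> * exp (- (real n * \<Lambda> / real q)) \<le> R; L2_set c {1..q} \<le> \<kappa>\<rbrakk> \<Longrightarrow>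
      \<exists>U t. U \<in> sets (lebesgue_vec q) \<and> t > 0 \<and> \<gamma> * t \<le> L * R \<and>
        (\<forall>b\<in>U. L2_set (\<lambda>i. b i - c i) {1..q} \<le> t \<and> L2_set b {1..q} \<le> L) \<and>
        measure (prior_measure r \<beta> q) U \<ge> p * exp (- (L * (real n * R)))"
    by (rule prior_mass_near_sieve_approximation[OF prior_params \<kappa>]) blast
  let ?R = "\<lambda>n. rate P m phi q g_star B lam n"
  let ?dev = "\<lambda>n \<omega>. SUP g\<in>sieve_box phi (q n) (B n).
             \<bar>ereal (G_bar rho n (k n) (\<lambda>i. D i \<omega>) g) - moment_crit P m g\<bar>"
  show "tendsto_in_prob M ?post 1"
    unfolding tendsto_in_prob_def
  proof (intro allI impI)
    fix \<eta> :: real assume \<eta>: "\<eta> > 0"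
    show "(\<lambda>n. outer_measure_of M {\<omega> \<in> space M. \<bar>?post n \<omega> - 1\<bar> > \<eta>}) \<longlonglongrightarrow> 0"
    proof (rule order_tendstoI)
      \<comment> \<open>The uniform deviation exceeds \<open>K1 * lam n\<close> with outer probability at most \<open>e < a\<close>; off that
        event the posterior bound is deterministic.\<close>
      fix a :: ennreal assume "0 < a"
      then obtain e0 where e0: "0 < e0" "e0 < a" using dense by blast
      define e where "e = enn2real e0"
      have e: "e > 0" "ennreal e < a"
        using e0 by (auto simp: e_def enn2real_positive_iff less_top[symmetric] ennreal_enn2real_if)
      from A2[unfolded bigo_in_prob_def] e(1) obtain K1 where
        K1: "eventually (\<lambda>n. outer_measure_of M {\<omega>\<in>space M. \<bar>?dev n \<omega>\<bar> > ereal (K1 * lam n)} \<le> ennreal e) sequentially"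
        by blast
      define K where "K = max K1 0"
      define c where "c = 1 + 2 * C * L"
      define Q where "Q = (c + K) / 2 + L"
      have K: "K \<ge> 0" "K1 \<le> K" by (auto simp: K_def)
      have Q: "Q \<ge> 0" using C L K by (simp add: Q_def c_def)
      \<comment> \<open>Chosen so that the two rate conditions become the separation and tail hypotheses of
        \<open>posterior_concentration_bound\<close>.\<close>
      define \<delta>1 where "\<delta>1 = 1 / (K + 2 * Q + 2)"
      define \<delta>2 where "\<delta>2 = \<beta> powr r / (Q + 1)"
      have \<delta>: "\<delta>1 > 0" "\<delta>2 > 0" using K Q prior_params by (auto simp: \<delta>1_def \<delta>2_def)
      have ev_sep: "eventually (\<lambda>n. ?R n \<le> ereal \<delta>1 * (INF g\<in>sieve_space phi (q n) - enlargement ?T \<epsilon>.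
                    moment_crit P m g)) sequentially"
        using rate_separation[OF \<epsilon>] \<delta> by (simp add: ereal_smallo_def)
      have ev_prior: "eventually (\<lambda>n. ?R n \<le> ereal \<delta>2 * ereal (B n powr r / real n)) sequentially"
        using rate_prior \<delta> by (simp add: ereal_smallo_def)
      have ev_B: "eventually (\<lambda>n. B n \<ge> L + \<kappa> + 1) sequentially"
        using B_at_top by (simp add: filterlim_at_top)
      have q_real: "filterlim (\<lambda>n. real (q n)) at_top sequentially"
        by (rule filterlim_compose[OF filterlim_real_sequentially q_at_top])
      have ev_q: "eventually (\<lambda>n. real (q n) \<ge> max 1 r) sequentially"
        using q_real by (simp only: filterlim_at_top)
      have "filterlim (\<lambda>n. min (real (q n)) (real n / exp 1)) at_top sequentially"
      proof -
        have "filterlim (\<lambda>n. real n / exp 1) at_top sequentially" by real_asymp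
        thus ?thesis using q_real unfolding filterlim_at_top
          by (auto simp: eventually_conj_iff)
      qed
      hence ev_x: "eventually (\<lambda>n. min (real (q n)) (real n / exp 1) \<ge> ln (2 / p / \<eta>)) sequentially"
        by (simp only: filterlim_at_top)
      have ev_n: "eventually (\<lambda>n. n \<ge> 1) sequentially" by (rule eventually_ge_at_top)
      have "eventually (\<lambda>n. outer_measure_of M {\<omega> \<in> space M. \<bar>?post n \<omega> - 1\<bar> > \<eta>} \<le> ennreal e) sequentially"
        using K1 ev_sep ev_prior ev_B ev_q ev_x ev_n
      proof eventually_elim
        case (elim n)
        have n: "n \<ge> 1" by fact
        have q: "q n \<ge> 1" "r \<le> real (q n)" using \<open>real (q n) \<ge> max 1 r\<close> by auto
        have B: "B n \<ge> L + \<kappa> + 1" by fact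
        let ?F = "sieve_box phi (q n) (B n)"
        have star: "g_star n \<in> ?F"
        proof -
          have "\<bar>b_star n i\<bar> \<le> B n" if "i \<in> {1..q n}" for i
            using abs_le_L2_set[OF that, of "b_star n"] b\<kappa>[of n] B L by linarith
          thus ?thesis unfolding A3_g_star by (rule sieve_box_memI)
        qed
        have R_ge: "moment_crit P m (g_star n) \<le> ?R n" "ereal (lam n) \<le> ?R n"
            "gamma_bound m ?F * ereal (exp (- (real n * lam n / real (q n)))) \<le> ?R n"
          unfolding rate_def by (intro Max_ge, simp, simp)+
        have "?R n < \<infinity>" using \<open>?R n \<le> ereal \<delta>2 * ereal (B n powr r / real n)\<close>
          by (auto intro: le_less_trans)
        moreover have "?R n > 0" using A2_lam(1)[of n] R_ge(2) by (metis ereal_less(2) less_le_trans)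
        \<comment> \<open>Comparison with the finite prior rate makes the maximum, and with it \<open>\<gamma>\<close>, finite.\<close>
        ultimately obtain R where R: "?R n = ereal R" by (cases "?R n") auto
        have lamR: "lam n \<le> R" using R_ge(2) R by simp
        have "gamma_bound m ?F \<noteq> \<infinity>" using R_ge(3) R by auto
        moreover have g1: "gamma_bound m ?F \<ge> 1" by (rule gamma_bound_ge_1[OF star])
        ultimately obtain \<gamma> where \<gamma>: "gamma_bound m ?F = ereal \<gamma>" by (cases "gamma_bound m ?F") auto
        have \<gamma>1: "\<gamma> \<ge> 1" using g1 \<gamma> by (simp add: one_ereal_def)
        have \<gamma>R: "\<gamma> * exp (- (real n * lam n / real (q n))) \<le> R" using R_ge(3) R \<gamma> by simp
        have bd: "\<bar>m g w\<bar> \<le> \<gamma>" if "g \<in> ?F" "w \<in> cbox 0 1" for g w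
          using gamma_bound_upper[OF that, of m] \<gamma> by simp
        obtain U t where U: "U \<in> sets (lebesgue_vec (q n))" and t: "t > 0" "\<gamma> * t \<le> L * R"
          and Ut: "\<And>b. b \<in> U \<Longrightarrow> L2_set (\<lambda>i. b i - b_star n i) {1..q n} \<le> t"
          and UL: "\<And>b. b \<in> U \<Longrightarrow> L2_set b {1..q n} \<le> L"
          and Up: "measure (prior_measure r \<beta> (q n)) U \<ge> p * exp (- (L * (real n * R)))"
          using mass[OF q A2_lam(1) lamR \<gamma>1 \<gamma>R b\<kappa>] by blast
        have U_box: "\<bar>b i\<bar> \<le> B n" if "b \<in> U" "i \<in> {1..q n}" for b i
          using abs_le_L2_set[OF that(2), of b] UL[OF that(1)] B \<kappa> by linarith
        have JU: "moment_crit P m (sieve_elem phi (q n) b) \<le> ereal (c * R)" if b: "b \<in> U" for b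
        proof -
          let ?g = "sieve_elem phi (q n) b"
          have g: "?g \<in> ?F" using U_box[OF b] by (rule sieve_box_memI)
          have "(\<integral>\<^sup>+y. ennreal \<bar>m ?g (snd y) - m (g_star n) (snd y)\<bar> \<partial>P)
              \<le> (\<integral>\<^sup>+y. ennreal \<bar>rho (fst y) ?g - rho (fst y) (g_star n)\<bar> \<partial>P)"
            by (rule cond_mean_L1_contraction[OF P sets_P rho_integrable cond_mean])
          also have "\<dots> \<le> ennreal C * (\<integral>\<^sup>+ y. ennreal \<bar>evl ?g (X y) - evl (g_star n) (X y)\<bar> \<partial>P)"
            by (rule lip)
          also have "\<dots> \<le> ennreal C * ennreal t"
            unfolding A3_g_star
            by (intro mult_left_mono sieve_L1_le_L2[OF P covariate function_sp A3_orthonormal t(1) Ut[OF b]]) auto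
          also have "\<dots> = ennreal (C * t)" using C by (simp add: ennreal_mult')
          finally have "moment_crit P m ?g \<le> moment_crit P m (g_star n) + ereal (2 * \<gamma> * (C * t))"
            using C t \<gamma>1 by (intro moment_crit_perturbation[OF snd_P m_meas W_range bd bd])
              (auto intro: g star)
          also have "\<dots> \<le> ereal R + ereal (2 * C * (L * R))"
          proof (rule add_mono)
            show "moment_crit P m (g_star n) \<le> ereal R" using R_ge(1) R by simp
            have "2 * C * (\<gamma> * t) \<le> 2 * C * (L * R)" using t C by (intro mult_left_mono) auto
            thus "ereal (2 * \<gamma> * (C * t)) \<le> ereal (2 * C * (L * R))" by (simp add: mult_ac)
          qed
          finally show ?thesis by (simp add: c_def algebra_simps)
        qed
        have sep: "ereal ((K + 2 * Q + 2) * R) \<le> moment_crit P m g"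
          if "g \<in> sieve_space phi (q n)" "g \<notin> enlargement ?T \<epsilon>" for g
        proof -
          have "ereal R \<le> ereal \<delta>1 * (INF g\<in>sieve_space phi (q n) - enlargement ?T \<epsilon>. moment_crit P m g)"
            using elim(2) R by simp
          also have "\<dots> \<le> ereal \<delta>1 * moment_crit P m g"
            using that \<delta> by (intro ereal_mult_left_mono INF_lower) auto
          finally show ?thesis using K Q
            by (cases "moment_crit P m g") (auto simp: \<delta>1_def field_simps split: if_splits)
        qed
        have tail: "(Q + 1) * (real n * R) \<le> \<beta> powr r * B n powr r"
        proof -
          have "R \<le> \<delta>2 * (B n powr r / real n)" using elim(3) R by simp
          hence "(Q + 1) * (real n * R) \<le> (Q + 1) * (real n * (\<delta>2 * (B n powr r / real n)))"
            using Q by (intro mult_left_mono) auto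
          also have "\<dots> = \<beta> powr r * B n powr r" using n Q by (simp add: \<delta>2_def)
          finally show ?thesis .
        qed
        have nR: "min (real (q n)) (real n / exp 1) \<le> real n * R"
        proof (cases "real n * lam n \<ge> real (q n)")
          case True
          have "real n * lam n \<le> real n * R" using lamR by (intro mult_left_mono) auto
          thus ?thesis using True by simp
        next
          case False
          have "exp (- 1) \<le> exp (- (real n * lam n / real (q n)))"
            using False q by (simp add: divide_simps)
          also have "\<dots> \<le> \<gamma> * exp (- (real n * lam n / real (q n)))" using \<gamma>1 by simp
          also have "\<dots> \<le> R" by (rule \<gamma>R)
          finally have "real n * exp (- 1) \<le> real n * R" by (intro mult_left_mono) auto
          thus ?thesis by (simp add: exp_minus divide_inverse)
        qed
        have small: "2 / p * exp (- (real n * R)) \<le> \<eta>"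
        proof -
          have "ln (2 / p / \<eta>) \<le> real n * R" using elim(6) nR by linarith
          hence "exp (ln (2 / p / \<eta>)) \<le> exp (real n * R)" by simp
          hence "2 / p / \<eta> \<le> exp (real n * R)" using p \<eta> by simp
          thus ?thesis using p \<eta> by (simp add: exp_minus field_simps)
        qed
        have "{\<omega> \<in> space M. \<bar>?post n \<omega> - 1\<bar> > \<eta>} \<subseteq> {\<omega>\<in>space M. \<bar>?dev n \<omega>\<bar> > ereal (K1 * lam n)}"
        proof (rule subsetI, rule ccontr)
          fix \<omega> assume w: "\<omega> \<in> {\<omega> \<in> space M. \<bar>?post n \<omega> - 1\<bar> > \<eta>}"
            and nw: "\<omega> \<notin> {\<omega>\<in>space M. \<bar>?dev n \<omega>\<bar> > ereal (K1 * lam n)}"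
          have "?dev n \<omega> \<le> \<bar>?dev n \<omega>\<bar>" by (cases "?dev n \<omega>") auto
          also have "\<dots> \<le> ereal (K1 * lam n)" using w nw by (simp add: not_less)
          also have "\<dots> \<le> ereal (K * R)"
            using K lamR A2_lam(1)[of n] by (auto intro!: mult_mono)
          finally have dev: "?dev n \<omega> \<le> ereal (K * R)" .
          have unif: "\<bar>ereal (G_bar rho n (k n) (\<lambda>i. D i \<omega>) g) - moment_crit P m g\<bar> \<le> ereal (K * R)"
            if "g \<in> ?F" for g
            using order_trans[OF SUP_upper[OF that] dev] .
          have "\<bar>?post n \<omega> - 1\<bar> \<le> 2 / p * exp (- (real n * R))"
          proof (rule posterior_concentration_bound[OF q(1) prior_params])
            show "B n > 0" using B L \<kappa> by linarith
            show "fst (D i \<omega>) \<in> space S" for i using w by (intro fst_D) auto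
          qed (fact rho_measurable unif U U_box JU p Up Q_def sep tail)+
          thus False using small w by auto
        qed
        from outer_measure_of_mono[OF this] elim(1) show ?case by (rule order_trans)
      qed
      thus "eventually (\<lambda>n. outer_measure_of M {\<omega> \<in> space M. \<bar>?post n \<omega> - 1\<bar> > \<eta>} < a) sequentially"
        using e(2) by (elim eventually_mono) (rule le_less_trans)
    qed simp
  qed
qed

end
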